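(* (Type $A$.) Let $k\geq1$ and $m\geq 2k+2$ be integers, $n=m-2k-1$, $W=\mathfrak S_{n+1}$ of type $A_n$ with generators $s_i=(i\ i+1)$, $c$ a Coxeter element with reduced word $\mathbf{c}$, $Q=\mathbf{c}^k\mathbf{w}_\circ(\mathbf{c})$, and $\varphi_A$ the bijection below from positions of $Q$ to $k$-relevant diagonals of a convex $m$-gon. Then for every position $q$ of $Q$, $\varphi_A(\Theta(q))$ is obtained from $\varphi_A(q)$ by rotating one step clockwise (i.e. $[a,b]\mapsto[a+1,b+1]$ mod $m$). (Type $B$.) Let $k\geq1$ and $m>k$ be integers, $n=m-k$, $W$ of type $B_n$ with generators $s_1,\dots,s_n$ where $(s_1s_2)^4=1$, $(s_is_{i+1})^3=1$ for $1<i<n$, and all other pairs of distinct generators commute, $c$ a Coxeter element with reduced word $\mathbf{c}$, $Q=\mathbf{c}^k\mathbf{w}_\circ(\mathbf{c})$, and $\varphi_B$ the bijection below from positions of $Q$ to symmetric pairs of $k$-relevant diagonals of a regular $2m$-gon. Then for every position $q$ of $Q$, $\varphi_B(\Theta(q))$ is obtained from $\varphi_B(q)$ by rotating one step clockwise (adding $1$ mod $2m$ to all endpoints).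
   Context: $w_\circ$ is the longest element, $\psi(s)=w_\circ^{-1}sw_\circ$, and $\mathbf{w}_\circ(\mathbf{c})$ is the lexicographically first (as a sequence of positions) subword of $\mathbf{c}\mathbf{c}\cdots$ which is a reduced expression for $w_\circ$. For $Q=(q_1,\dots,q_r)$, $\Theta$ sends a position $i$ with $q_i=s$ to the next position $j>i$ with $q_j=s$ if it exists, and otherwise to the first position $j$ with $q_j=\psi(s)$. A diagonal of a polygon is $k$-relevant if at least $k$ polygon vertices lie strictly on each side of it. For $i\in\{1,\dots,n\}$ let $p_i$ be the position of $s_i$ in $\mathbf{c}$. Type $A$: label the vertices of the convex $m$-gon $0,\dots,m-1$ clockwise; set $a_i=|\{j<i: p_j<p_{j+1}\}| \bmod m$ and $b_i=-k-1-|\{j<i:p_j>p_{j+1}\}| \bmod m$; $\varphi_A$ sends the $\ell$-th occurrence of $s_i$ in $Q$ to the diagonal obtained by rotating $[a_i,b_i]$ clockwise $\ell-1$ times; this is a bijection onto the $k$-relevant diagonals. Type $B$: label the vertices of the regular $2m$-gon $0,\dots,2m-1$ clockwise; a symmetric pair is an orbit $\{[a,b],[a+m,b+m]\}$ (indices mod $2m$) of a $k$-relevant diagonal under central symmetry (a single diagonal for diameters); set $a_i=|\{j<i:p_j<p_{j+1}\}|$ and $b_i=m-|\{j<i:p_j>p_{j+1}\}|$; $\varphi_B$ sends the $\ell$-th occurrence of $s_i$ in $Q$ to the symmetric pair obtained by rotating $\{[a_i,b_i],[a_i+m,b_i+m]\}$ clockwise $\ell-1$ times; this is a bijection onto the symmetric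 pairs of $k$-relevant diagonals. *)

theory Defs
  imports "HOL-Algebra.Sym_Groups" "HOL-Algebra.Generated_Groups"
begin

text \<open>
  Throughout, \<open>s i\<close> for \<open>i \<in> {1..n}\<close> are the simple generators of a group \<open>G\<close>, and a word is the
  list of the indices of its letters. Positions in a word are counted from 0.
\<close>

definition word_prod :: "('a, 'b) monoid_scheme \<Rightarrow> (nat \<Rightarrow> 'a) \<Rightarrow> nat list \<Rightarrow> 'a" where
  "word_prod G s ws = foldr (\<lambda>i x. s i \<otimes>\<^bsub>G\<^esub> x) ws \<one>\<^bsub>G\<^esub>"

text \<open>
  The congruence on words over \<open>{1..n}\<close> generated by the relations \<open>(s\<^sub>i s\<^sub>j)\<^bsup>M i j\<^esup> = 1\<close>. For a
  Coxeter matrix \<open>M\<close> we have \<open>M i i = 1\<close>, so all generators are involutions and the quotient monoid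
  is the group presented by \<open>M\<close>.
\<close>

inductive cox_equiv :: "(nat \<Rightarrow> nat \<Rightarrow> nat) \<Rightarrow> nat \<Rightarrow> nat list \<Rightarrow> nat list \<Rightarrow> bool"
  for M :: "nat \<Rightarrow> nat \<Rightarrow> nat" and n :: nat where
  rel: "\<lbrakk>i \<in> {1..n}; j \<in> {1..n}; set u \<subseteq> {1..n}; set v \<subseteq> {1..n}\<rbrakk>
    \<Longrightarrow> cox_equiv M n (u @ concat (replicate (M i j) [i, j]) @ v) (u @ v)"
| refl: "cox_equiv M n u u"
| sym: "cox_equiv M n u v \<Longrightarrow> cox_equiv M n v u"
| trans: "\<lbrakk>cox_equiv M n u v; cox_equiv M n v w\<rbrakk> \<Longrightarrow> cox_equiv M n u w"

definition coxeter_system ::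
  "('a, 'b) monoid_scheme \<Rightarrow> (nat \<Rightarrow> 'a) \<Rightarrow> nat \<Rightarrow> (nat \<Rightarrow> nat \<Rightarrow> nat) \<Rightarrow> bool" where
  "coxeter_system G s n M \<longleftrightarrow>
     group G \<and> s ` {1..n} \<subseteq> carrier G \<and> generate G (s ` {1..n}) = carrier G \<and>
     (\<forall>u v. set u \<subseteq> {1..n} \<longrightarrow> set v \<subseteq> {1..n} \<longrightarrow>
        (word_prod G s u = word_prod G s v \<longleftrightarrow> cox_equiv M n u v))"

definition cox_matrix_B :: "nat \<Rightarrow> nat \<Rightarrow> nat" where
  "cox_matrix_B i j =
     (if i = j then 1
      else if {i, j} = {1, 2} then 4
      else if i = j + 1 \<or> j = i + 1 then 3
      else 2)"

definition adj_transp :: "nat \<Rightarrow> nat \<Rightarrow> nat" where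
  "adj_transp i = transpose i (i + 1)"

definition cox_length :: "('a, 'b) monoid_scheme \<Rightarrow> (nat \<Rightarrow> 'a) \<Rightarrow> nat \<Rightarrow> 'a \<Rightarrow> nat" where
  "cox_length G s n x =
     (LEAST l. \<exists>ws. set ws \<subseteq> {1..n} \<and> length ws = l \<and> word_prod G s ws = x)"

definition reduced_word ::
  "('a, 'b) monoid_scheme \<Rightarrow> (nat \<Rightarrow> 'a) \<Rightarrow> nat \<Rightarrow> nat list \<Rightarrow> 'a \<Rightarrow> bool" where
  "reduced_word G s n ws x \<longleftrightarrow>
     set ws \<subseteq> {1..n} \<and> word_prod G s ws = x \<and> length ws = cox_length G s n x"

definition coxeter_element :: "('a, 'b) monoid_scheme \<Rightarrow> (nat \<Rightarrow> 'a) \<Rightarrow> nat \<Rightarrow> 'a \<Rightarrow> bool" where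
  "coxeter_element G s n c \<longleftrightarrow>
     (\<exists>ws. distinct ws \<and> set ws = {1..n} \<and> word_prod G s ws = c)"

definition longest_element :: "('a, 'b) monoid_scheme \<Rightarrow> (nat \<Rightarrow> 'a) \<Rightarrow> nat \<Rightarrow> 'a" where
  "longest_element G s n =
     (THE w. w \<in> carrier G \<and> (\<forall>x\<in>carrier G. cox_length G s n x \<le> cox_length G s n w))"

definition psi :: "('a, 'b) monoid_scheme \<Rightarrow> (nat \<Rightarrow> 'a) \<Rightarrow> nat \<Rightarrow> 'a \<Rightarrow> 'a" where
  "psi G s n x =
     inv\<^bsub>G\<^esub> (longest_element G s n) \<otimes>\<^bsub>G\<^esub> x \<otimes>\<^bsub>G\<^esub> longest_element G s n"

text \<open>The letter at position \<open>p\<close> of the infinite word \<open>cw cw cw \<dots>\<close>.\<close>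

definition periodic_letter :: "nat list \<Rightarrow> nat \<Rightarrow> nat" where
  "periodic_letter cw p = cw ! (p mod length cw)"

definition longest_subword ::
  "('a, 'b) monoid_scheme \<Rightarrow> (nat \<Rightarrow> 'a) \<Rightarrow> nat \<Rightarrow> nat list \<Rightarrow> nat list \<Rightarrow> bool" where
  "longest_subword G s n cw ps \<longleftrightarrow>
     sorted_wrt (<) ps \<and>
     reduced_word G s n (map (periodic_letter cw) ps) (longest_element G s n)"

definition sorting_word :: "('a, 'b) monoid_scheme \<Rightarrow> (nat \<Rightarrow> 'a) \<Rightarrow> nat \<Rightarrow> nat list \<Rightarrow> nat list" where
  "sorting_word G s n cw = map (periodic_letter cw)
     (THE ps. longest_subword G s n cw ps \<and>
        (\<forall>qs. longest_subword G s n cw qs \<longrightarrow> ps = qs \<or> (ps, qs) \<in> lexord less_than))"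

definition Q_word ::
  "('a, 'b) monoid_scheme \<Rightarrow> (nat \<Rightarrow> 'a) \<Rightarrow> nat \<Rightarrow> nat \<Rightarrow> nat list \<Rightarrow> nat list" where
  "Q_word G s n k cw = concat (replicate k cw) @ sorting_word G s n cw"

definition Theta ::
  "('a, 'b) monoid_scheme \<Rightarrow> (nat \<Rightarrow> 'a) \<Rightarrow> nat \<Rightarrow> nat list \<Rightarrow> nat \<Rightarrow> nat" where
  "Theta G s n Q q =
     (if \<exists>j. q < j \<and> j < length Q \<and> Q ! j = Q ! q
      then LEAST j. q < j \<and> j < length Q \<and> Q ! j = Q ! q
      else LEAST j. j < length Q \<and> s (Q ! j) = psi G s n (s (Q ! q)))"

definition pos_in :: "nat list \<Rightarrow> nat \<Rightarrow> nat" where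
  "pos_in cw i = (THE p. p < length cw \<and> cw ! p = i)"

definition ascents_below :: "nat list \<Rightarrow> nat \<Rightarrow> nat" where
  "ascents_below cw i = card {j. 1 \<le> j \<and> j < i \<and> pos_in cw j < pos_in cw (j + 1)}"

definition descents_below :: "nat list \<Rightarrow> nat \<Rightarrow> nat" where
  "descents_below cw i = card {j. 1 \<le> j \<and> j < i \<and> pos_in cw j > pos_in cw (j + 1)}"

text \<open>The letter at position \<open>q\<close> is the \<open>occurrence Q q\<close>-th occurrence (from 1) of that letter.\<close>

definition occurrence :: "nat list \<Rightarrow> nat \<Rightarrow> nat" where
  "occurrence Q q = card {j. j \<le> q \<and> Q ! j = Q ! q}"

text \<open>
  The vertices of an \<open>N\<close>-gon are the integers \<open>0, \<dots>, N - 1\<close> in clockwise order; a diagonal is the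
  set of its endpoints.
\<close>

definition diagonal :: "nat \<Rightarrow> int \<Rightarrow> int \<Rightarrow> int set" where
  "diagonal N a b = {a mod int N, b mod int N}"

definition rotate_cw :: "nat \<Rightarrow> int set \<Rightarrow> int set" where
  "rotate_cw N D = (\<lambda>v. (v + 1) mod int N) ` D"

definition phi_A :: "nat \<Rightarrow> nat \<Rightarrow> nat list \<Rightarrow> nat list \<Rightarrow> nat \<Rightarrow> int set" where
  "phi_A k m cw Q q =
     (let i = Q ! q;
          a = int (ascents_below cw i);
          b = - int k - 1 - int (descents_below cw i)
      in (rotate_cw m ^^ (occurrence Q q - 1)) (diagonal m a b))"

text \<open>
  A centrally symmetric pair of diagonals of the \<open>2m\<close>-gon is the set of its diagonals, which is a
  singleton for a diameter.
\<close>

definition sym_pair :: "nat \<Rightarrow> int \<Rightarrow> int \<Rightarrow> int set set" where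
  "sym_pair m a b = {diagonal (2 * m) a b, diagonal (2 * m) (a + int m) (b + int m)}"

definition rotate_pair_cw :: "nat \<Rightarrow> int set set \<Rightarrow> int set set" where
  "rotate_pair_cw m P = rotate_cw (2 * m) ` P"

definition phi_B :: "nat \<Rightarrow> nat list \<Rightarrow> nat list \<Rightarrow> nat \<Rightarrow> int set set" where
  "phi_B m cw Q q =
     (let i = Q ! q;
          a = int (ascents_below cw i);
          b = int m - int (descents_below cw i)
      in (rotate_pair_cw m ^^ (occurrence Q q - 1)) (sym_pair m a b))"

end

theory Submission
  imports Defs
begin

text \<open>
  As long as a letter \<open>s\<^sub>i\<close> recurs in \<open>Q\<close>, \<open>\<Theta>\<close> increases its occurrence number by one, which is one
  rotation step. So the claim is about the last occurrence of each letter, and it reduces to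
  counting the occurrences of \<open>s\<^sub>i\<close> in the sorting word.

  In type \<open>A\<close> that number is \<open>1 + |{j < i : p\<^sub>j > p\<^sub>j\<^sub>+\<^sub>1}| + |{j < n + 1 - i : p\<^sub>j < p\<^sub>j\<^sub>+\<^sub>1}|\<close>. Reading
  \<open>c c c \<dots>\<close> and keeping only that many copies of each letter, one can follow every value of the one-line
  notation explicitly, because it moves along the \<open>(n + 1)\<close>-cycle \<open>c\<close>; the final state is the reversal.
  Whenever a letter is skipped, the prefix read so far already has a descent there, so no reduced word
  could have used it: the kept word is lexicographically first.

  In type \<open>B\<close>, folding sends \<open>c\<close> to a Coxeter element of the symmetric group on \<open>{1..2n}\<close> with all the
  above numbers equal to \<open>n\<close>, so \<open>c\<^sup>n\<close> maps to the reversal. Counting inversions shows that \<open>c\<^sup>n\<close> has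
  length at least \<open>n\<^sup>2\<close>, and a normal form shows that only one element can be that long. Hence
  \<open>c\<^sup>n\<close> is the longest element, it is central, and each letter occurs \<open>k + n = m\<close> times in \<open>Q\<close>, a half turn.
\<close>

section \<open>Words in adjacent transpositions\<close>

definition perm_of :: "nat list \<Rightarrow> nat \<Rightarrow> nat" where
  "perm_of w = foldr (\<lambda>i f. adj_transp i \<circ> f) w id"

lemma perm_of_Nil [simp]: "perm_of [] = id"
  by (simp add: perm_of_def)

lemma perm_of_Cons: "perm_of (i # w) = adj_transp i \<circ> perm_of w"
  by (simp add: perm_of_def)

lemma perm_of_append: "perm_of (u @ v) = perm_of u \<circ> perm_of v"
  by (induction u) (auto simp: perm_of_Cons)

lemma perm_of_snoc: "perm_of (w @ [i]) = perm_of w \<circ> adj_transp i"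
  by (simp add: perm_of_append perm_of_Cons)

lemma word_prod_sym_group: "word_prod (sym_group N) adj_transp w = perm_of w"
  by (simp add: word_prod_def perm_of_def sym_group_mult sym_group_one)

lemma adj_transp_apply:
  "adj_transp i a = (if a = i then Suc i else if a = Suc i then i else a)"
  by (simp add: adj_transp_def transpose_def)

lemma adj_transp_involutory [simp]: "adj_transp i (adj_transp i a) = a"
  by (simp add: adj_transp_def)

lemma bij_perm_of: "bij (perm_of w)"
proof (induction w)
  case (Cons i w)
  then show ?case
    unfolding perm_of_Cons by (rule bij_comp) (simp add: adj_transp_def)
qed (simp add: bij_id[unfolded id_def] id_def)

lemma adj_transp_permutes: "1 \<le> i \<Longrightarrow> i \<le> n \<Longrightarrow> adj_transp i permutes {1..n + 1}"
  unfolding adj_transp_def by (rule permutes_swap_id) auto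

lemma perm_of_permutes: "set w \<subseteq> {1..n} \<Longrightarrow> perm_of w permutes {1..n + 1}"
proof (induction w)
  case (Cons i w)
  then show ?case
    using adj_transp_permutes[of i n] unfolding perm_of_Cons by (intro permutes_compose) auto
qed (simp add: permutes_id)

text \<open>Only the letter \<open>j\<close> moves a point across the gap between \<open>j\<close>
  and \<open>j + 1\<close>, so every other letter preserves the initial segment up to
  \<open>j\<close>.\<close>

lemma perm_of_le_iff: "j \<notin> set w \<Longrightarrow> perm_of w a \<le> j \<longleftrightarrow> a \<le> j"
  by (induction w) (auto simp: perm_of_Cons adj_transp_apply)

text \<open>The single occurrence of \<open>j\<close> carries the value \<open>j\<close> across the
  gap, and no letter before or after it can cross back.\<close>

lemma perm_of_crosses:
  assumes "j \<notin> set u" "j \<notin> set v"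
  shows "\<exists>a. a \<le> j \<and> j < perm_of (u @ j # v) a"
proof -
  obtain a where a: "perm_of v a = j"
    using bij_perm_of[of v] by (metis bij_pointE)
  then have "a \<le> j"
    using perm_of_le_iff[OF assms(2), of a] by simp
  moreover have "j < perm_of u (Suc j)"
    using perm_of_le_iff[OF assms(1), of "Suc j"] by simp
  ultimately show ?thesis
    using a by (intro exI[of _ a]) (simp add: perm_of_append perm_of_Cons adj_transp_apply)
qed

text \<open>The crossing forced by a single occurrence of \<open>j\<close> contradicts the segment
  preserved in its absence. This support argument makes every word for a Coxeter element use all
  letters.\<close>

lemma perm_of_single_letter_needed:
  assumes "perm_of w = perm_of w'" "j \<in> set w'" "distinct w'"
  shows "j \<in> set w"
proof (rule ccontr)
  assume "j \<notin> set w"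
  obtain u v where w': "w' = u @ j # v"
    using assms(2) by (meson split_list)
  then obtain a where "a \<le> j" "j < perm_of w' a"
    using perm_of_crosses[of j u v] assms(3) by auto
  with perm_of_le_iff[OF \<open>j \<notin> set w\<close>, of a] assms(1) show False
    by simp
qed

section \<open>Inversions and the length of a permutation\<close>

definition inversions :: "nat \<Rightarrow> (nat \<Rightarrow> nat) \<Rightarrow> (nat \<times> nat) set" where
  "inversions n f = {(a, b). 1 \<le> a \<and> a < b \<and> b \<le> n + 1 \<and> f b < f a}"

lemma finite_inversions [simp]: "finite (inversions n f)"
  by (rule finite_subset[of _ "{..n + 1} \<times> {..n + 1}"]) (auto simp: inversions_def)

text \<open>Exchanging \<open>i\<close> and \<open>i + 1\<close> in both coordinates keeps the order
  of every pair except \<open>(i, i + 1)\<close>, so it is a bijection between the remaining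
  inversions.\<close>

lemma card_inversions_swap:
  assumes "1 \<le> i" "i \<le> n"
  shows "card (inversions n (f \<circ> adj_transp i) - {(i, Suc i)}) = card (inversions n f - {(i, Suc i)})"
proof (rule bij_betw_same_card)
  let ?g = "map_prod (adj_transp i) (adj_transp i)"
  have maps: "?g p \<in> inversions n h - {(i, Suc i)}"
    if "p \<in> inversions n (h \<circ> adj_transp i) - {(i, Suc i)}" for h p
  proof -
    obtain a b where p: "p = (a, b)"
      by force
    then have ab: "1 \<le> a" "a < b" "b \<le> n + 1" "h (adj_transp i b) < h (adj_transp i a)"
      "a = i \<Longrightarrow> b \<noteq> Suc i"
      using that by (auto simp: inversions_def)
    have "adj_transp i a < adj_transp i b" "1 \<le> adj_transp i a" "adj_transp i b \<le> n + 1"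
      "adj_transp i a = i \<Longrightarrow> adj_transp i b \<noteq> Suc i"
      using ab assms by (auto simp: adj_transp_apply split: if_splits)
    then show ?thesis
      using ab(4) by (auto simp: p inversions_def)
  qed
  have inverse: "?g (?g p) = p" for p
    by (cases p) simp
  have twice: "f \<circ> adj_transp i \<circ> adj_transp i = f"
    by (rule ext) simp
  show "bij_betw ?g
     (inversions n (f \<circ> adj_transp i) - {(i, Suc i)}) (inversions n f - {(i, Suc i)})"
  proof (rule bij_betw_byWitness[where f' = ?g])
    show "?g ` (inversions n (f \<circ> adj_transp i) - {(i, Suc i)}) \<subseteq> inversions n f - {(i, Suc i)}"
      using maps[of _ f] by (rule image_subsetI)
    show "?g ` (inversions n f - {(i, Suc i)}) \<subseteq> inversions n (f \<circ> adj_transp i) - {(i, Suc i)}"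
      using maps[of _ "f \<circ> adj_transp i", unfolded twice] by (rule image_subsetI)
  qed (auto simp only: inverse)
qed

lemma card_inversions_swap_le:
  assumes "1 \<le> i" "i \<le> n"
  shows "card (inversions n (f \<circ> adj_transp i)) \<le> card (inversions n f) + 1"
proof -
  have "card (inversions n (f \<circ> adj_transp i))
      \<le> card (inversions n (f \<circ> adj_transp i) - {(i, Suc i)}) + 1"
    unfolding card_Diff_singleton_if by auto
  also have "\<dots> \<le> card (inversions n f) + 1"
    using card_inversions_swap[OF assms] by (simp add: card_Diff1_le)
  finally show ?thesis .
qed

lemma card_inversions_swap_descent:
  assumes "1 \<le> i" "i \<le> n" "f (Suc i) < f i"
  shows "card (inversions n f) = card (inversions n (f \<circ> adj_transp i)) + 1"
proof -
  have "(i, Suc i) \<in> inversions n f" "(i, Suc i) \<notin> inversions n (f \<circ> adj_transp i)"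
    using assms by (auto simp: inversions_def adj_transp_apply)
  then show ?thesis
    using card_inversions_swap[OF assms(1,2), of f]
      card_Suc_Diff1[of "inversions n f" "(i, Suc i)"] by simp
qed

text \<open>Each letter creates at most one inversion. The prefix \<open>u\<close> is kept apart so
  that a letter wasted after a prefix can be charged against the letters still to come.\<close>

lemma card_inversions_append:
  "set v \<subseteq> {1..n} \<Longrightarrow>
    card (inversions n (perm_of (u @ v))) \<le> card (inversions n (perm_of u)) + length v"
proof (induction v rule: rev_induct)
  case (snoc i v)
  then have "card (inversions n (perm_of (u @ v) \<circ> adj_transp i))
      \<le> card (inversions n (perm_of (u @ v))) + 1"
    by (intro card_inversions_swap_le) auto
  moreover have "card (inversions n (perm_of (u @ v))) \<le> card (inversions n (perm_of u)) + length v"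
    using snoc by simp
  ultimately have "card (inversions n (perm_of (u @ v) \<circ> adj_transp i))
      \<le> card (inversions n (perm_of u)) + length (v @ [i])"
    unfolding length_append_singleton by linarith
  then show ?case
    by (metis append_assoc perm_of_snoc)
qed simp

lemma inversions_id [simp]: "inversions n id = {}"
  by (auto simp: inversions_def)

lemma card_inversions_perm_of:
  "set w \<subseteq> {1..n} \<Longrightarrow> card (inversions n (perm_of w)) \<le> length w"
  using card_inversions_append[of w n "[]"] by simp

text \<open>Bubble sort: undoing a descent removes exactly one inversion, and a permutation without
  descents is the identity.\<close>

lemma exists_word_of_inversions:
  assumes "f permutes {1..n + 1}"
  shows "\<exists>w. set w \<subseteq> {1..n} \<and> length w = card (inversions n f) \<and> perm_of w = f"
  using assms
proof (induction "card (inversions n f)" arbitrary: f rule: less_induct)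
  case less
  show ?case
  proof (cases "\<exists>i. 1 \<le> i \<and> i \<le> n \<and> f (Suc i) < f i")
    case True
    then obtain i where i: "1 \<le> i" "i \<le> n" "f (Suc i) < f i"
      by blast
    have "f \<circ> adj_transp i permutes {1..n + 1}"
      using adj_transp_permutes[OF i(1,2)] less.prems by (rule permutes_compose)
    with less.hyps[of "f \<circ> adj_transp i"] card_inversions_swap_descent[of i n f, OF i]
    obtain w where "set w \<subseteq> {1..n}" "length w = card (inversions n (f \<circ> adj_transp i))"
      "perm_of w = f \<circ> adj_transp i"
      by auto
    with i card_inversions_swap_descent[of i n f, OF i] show ?thesis
      by (intro exI[of _ "w @ [i]"]) (auto simp: perm_of_snoc)
  next
    case False
    have inj: "inj f"
      using less.prems by (rule permutes_inj)
    have step: "f i < f (Suc i)" if "1 \<le> i" "i \<le> n" for i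
    proof -
      have "f i \<noteq> f (Suc i)"
        using inj by (simp add: inj_eq)
      with False that show ?thesis
        by force
    qed
    \<comment> \<open>Without descents \<open>f\<close> is strictly increasing, and the bounds at
      \<open>1\<close> and \<open>n + 1\<close> squeeze \<open>f a\<close> to
      \<open>a\<close>.\<close>
    have lower: "a + d \<le> n + 1 \<Longrightarrow> 1 \<le> a \<Longrightarrow> f a + d \<le> f (a + d)" for a d
    proof (induction d)
      case (Suc d)
      then show ?case
        using step[of "a + d"] by simp
    qed simp
    have fixed: "f a = a" if "a \<in> {1..n + 1}" for a
    proof -
      have "1 \<le> f 1" "f (n + 1) \<le> n + 1"
        using permutes_in_image[OF less.prems] by (metis atLeastAtMost_iff le_add2 order_refl)+
      moreover have "f 1 + (a - 1) \<le> f a" "f a + (n + 1 - a) \<le> f (n + 1)"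
        using that lower[of 1 "a - 1"] lower[of a "n + 1 - a"] by auto
      ultimately show ?thesis
        using that by auto
    qed
    have "f = id"
    proof
      fix a
      show "f a = id a"
        using fixed less.prems by (cases "a \<in> {1..n + 1}") (auto simp: permutes_def)
    qed
    then show ?thesis
      by (intro exI[of _ "[]"]) auto
  qed
qed

section \<open>The reversal, the permutation with all inversions\<close>

definition reversal :: "nat \<Rightarrow> nat \<Rightarrow> nat" where
  "reversal n a = (if 1 \<le> a \<and> a \<le> n + 1 then n + 2 - a else a)"

lemma reversal_involutory [simp]: "reversal n (reversal n a) = a"
  by (auto simp: reversal_def)

lemma reversal_permutes: "reversal n permutes {1..n + 1}"
  by (rule bij_imp_permutes[OF bij_betw_byWitness[where f' = "reversal n"]])
    (auto simp: reversal_def)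

definition index_pairs :: "nat \<Rightarrow> (nat \<times> nat) set" where
  "index_pairs n = {(a, b). 1 \<le> a \<and> a < b \<and> b \<le> n + 1}"

lemma finite_index_pairs [simp]: "finite (index_pairs n)"
  by (rule finite_subset[of _ "{..n + 1} \<times> {..n + 1}"]) (auto simp: index_pairs_def)

lemma inversions_subset: "inversions n f \<subseteq> index_pairs n"
  by (auto simp: inversions_def index_pairs_def)

lemma inversions_reversal: "inversions n (reversal n) = index_pairs n"
  by (auto simp: inversions_def index_pairs_def reversal_def)

lemma card_index_pairs: "2 * card (index_pairs n) = n * (n + 1)"
proof (induction n)
  case (Suc n)
  have "index_pairs (Suc n) = index_pairs n \<union> (\<lambda>a. (a, n + 2)) ` {1..n + 1}"
    by (auto simp: index_pairs_def)
  moreover have "card (index_pairs n \<union> (\<lambda>a. (a, n + 2)) ` {1..n + 1})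
      = card (index_pairs n) + card ((\<lambda>a. (a, n + 2)) ` {1..n + 1})"
    by (rule card_Un_disjoint) (simp, simp, auto simp: index_pairs_def)
  moreover have "card ((\<lambda>a. (a, n + 2)) ` {1..n + 1}) = n + 1"
    by (subst card_image) (auto simp: inj_on_def)
  ultimately have "card (index_pairs (Suc n)) = card (index_pairs n) + (n + 1)"
    by simp
  with Suc show ?case
    by simp
next
  case 0
  have "index_pairs 0 = {}"
    by (auto simp: index_pairs_def)
  then show ?case
    by simp
qed

text \<open>Every adjacent pair is a descent, so \<open>f\<close> drops by at least one at each step
  while only \<open>n + 1\<close> values are available.\<close>

lemma all_inversions_imp_reversal:
  assumes f: "f permutes {1..n + 1}" and inv: "inversions n f = index_pairs n"
  shows "f = reversal n"
proof
  fix x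
  have step: "f (Suc i) < f i" if "1 \<le> i" "i \<le> n" for i
  proof -
    have "(i, Suc i) \<in> inversions n f"
      unfolding inv using that by (simp add: index_pairs_def)
    then show ?thesis
      by (simp add: inversions_def)
  qed
  have lower: "a + d \<le> n + 1 \<Longrightarrow> 1 \<le> a \<Longrightarrow> f (a + d) + d \<le> f a" for a d
  proof (induction d)
    case (Suc d)
    then show ?case
      using step[of "a + d"] by simp
  qed simp
  show "f x = reversal n x"
  proof (cases "x \<in> {1..n + 1}")
    case True
    have "f 1 \<le> n + 1" "1 \<le> f (n + 1)"
      using permutes_in_image[OF f] by (metis atLeastAtMost_iff le_add2 order_refl)+
    moreover have "f x + (x - 1) \<le> f 1" "f (n + 1) + (n + 1 - x) \<le> f x"
      using True lower[of 1 "x - 1"] lower[of x "n + 1 - x"] by auto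
    ultimately show ?thesis
      using True by (auto simp: reversal_def)
  qed (use f in \<open>auto simp: permutes_def reversal_def\<close>)
qed

text \<open>Conjugation by the reversal reflects the Dynkin diagram; this becomes the description of
  \<open>psi\<close> in type A.\<close>

lemma adj_transp_reversal:
  assumes "1 \<le> i" "i \<le> n"
  shows "adj_transp i (reversal n a) = reversal n (adj_transp (n + 1 - i) a)"
proof -
  define r where "r = n + 1 - i"
  have r: "1 \<le> r" "n + 1 = i + r"
    using assms by (auto simp: r_def)
  show ?thesis
  proof (cases "1 \<le> a \<and> a \<le> n + 1")
    case True
    define b where "b = n + 2 - a"
    have b: "1 \<le> b" "a + b = i + Suc r"
      using True r by (auto simp: b_def)
    have "adj_transp r a + adj_transp i b = i + Suc r"
      using b unfolding adj_transp_apply by (cases "a = r"; cases "a = Suc r") simp_all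
    moreover have "1 \<le> adj_transp r a" "adj_transp r a \<le> n + 1"
      using True r assms by (simp_all add: adj_transp_apply)
    moreover have "reversal n a = b"
      using True by (simp add: reversal_def b_def)
    ultimately show ?thesis
      using r by (simp add: reversal_def flip: r_def)
  next
    case False
    then have "a \<noteq> i" "a \<noteq> Suc i" "a \<noteq> r" "a \<noteq> Suc r"
      using r assms by auto
    then have "adj_transp i a = a" "adj_transp r a = a"
      by (simp_all add: adj_transp_apply)
    moreover have "reversal n a = a"
      using False by (simp only: reversal_def if_False)
    ultimately show ?thesis
      unfolding r_def[symmetric] by simp
  qed
qed

section \<open>The product of the letters of a Coxeter word read cyclically\<close>

text \<open>Abstract form of \<open>ascents_below\<close>: an arbitrary predicate replaces the
  comparison of positions in the Coxeter word.\<close>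

definition ups :: "(nat \<Rightarrow> bool) \<Rightarrow> nat \<Rightarrow> nat" where
  "ups A i = card {j. 1 \<le> j \<and> j < i \<and> A j}"

definition downs :: "(nat \<Rightarrow> bool) \<Rightarrow> nat \<Rightarrow> nat" where
  "downs A i = card {j. 1 \<le> j \<and> j < i \<and> \<not> A j}"

lemma downs_eq_ups: "downs A = ups (\<lambda>j. \<not> A j)"
  by (simp add: fun_eq_iff ups_def downs_def)

lemma ups_1 [simp]: "ups A 1 = 0" "ups A (Suc 0) = 0"
  by (simp_all add: ups_def)

lemma downs_1 [simp]: "downs A 1 = 0" "downs A (Suc 0) = 0"
  by (simp_all add: downs_eq_ups)

lemma ups_Suc:
  assumes "1 \<le> i"
  shows "ups A (Suc i) = ups A i + of_bool (A i)"
proof -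
  have "{j. 1 \<le> j \<and> j < Suc i \<and> A j} = {j. 1 \<le> j \<and> j < i \<and> A j} \<union> (if A i then {i} else {})"
    using assms by (auto simp: less_Suc_eq)
  then show ?thesis
    by (simp add: ups_def)
qed

lemma downs_Suc: "1 \<le> i \<Longrightarrow> downs A (Suc i) = downs A i + of_bool (\<not> A i)"
  by (simp add: downs_eq_ups ups_Suc)

lemma ups_mono: "i \<le> j \<Longrightarrow> ups A i \<le> ups A j"
  unfolding ups_def by (rule card_mono) auto

lemma downs_mono: "i \<le> j \<Longrightarrow> downs A i \<le> downs A j"
  by (simp add: downs_eq_ups ups_mono)

lemma ups_plus_downs: "1 \<le> i \<Longrightarrow> ups A i + downs A i + 1 = i"
proof (induction i rule: dec_induct)
  case (step i)
  then show ?case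
    by (cases "A i") (simp_all add: ups_Suc downs_Suc)
qed simp

section \<open>Multiplicities of the letters and motion of the values on a circle\<close>

locale orientation =
  fixes n :: nat and A :: "nat \<Rightarrow> bool"
  assumes n_pos: "1 \<le> n"
begin

text \<open>The number of copies of \<open>i\<close> in the sorting word, as is shown later, when
  \<open>A j\<close> records that \<open>j\<close> precedes \<open>j + 1\<close> in the Coxeter
  word.\<close>

definition mult :: "nat \<Rightarrow> nat" where
  "mult i = 1 + downs A i + ups A (n + 1 - i)"

lemma mult_le:
  assumes "1 \<le> i" "i \<le> n"
  shows "mult i \<le> n"
proof -
  have "ups A i + downs A i + 1 = i" "ups A (n + 1 - i) + downs A (n + 1 - i) + 1 = n + 1 - i"
    using assms by (intro ups_plus_downs; simp)+
  then show ?thesis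
    using assms unfolding mult_def by linarith
qed

text \<open>Neighbouring multiplicities differ by at most one, in a direction fixed by the edge at
  \<open>i\<close> and its mirror image at \<open>n - i\<close>. All comparisons of truncated counts
  below rest on this.\<close>

lemma mult_Suc:
  assumes "1 \<le> i" "i < n"
  shows "mult (Suc i) + of_bool (A (n - i)) = mult i + of_bool (\<not> A i)"
proof -
  have "n + 1 - i = Suc (n - i)" "n + 1 - Suc i = n - i"
    using assms by auto
  then show ?thesis
    using assms ups_Suc[of "n - i" A] downs_Suc[of i A] by (simp add: mult_def)
qed

text \<open>Reversing the index in the last summand puts \<open>ups\<close> and \<open>downs\<close>
  at the same \<open>i\<close>, where with the constant one they add up to \<open>i\<close>. The sum
  is therefore the number of inversions of the reversal.\<close>

lemma sum_mult: "2 * (\<Sum>i = 1..n. mult i) = n * (n + 1)"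
proof -
  have "(\<Sum>i = 1..n. ups A (n + 1 - i)) = (\<Sum>i = 1..n. ups A i)"
    by (rule sum.reindex_bij_witness[of _ "\<lambda>i. n + 1 - i" "\<lambda>i. n + 1 - i"]) auto
  then have "(\<Sum>i = 1..n. mult i) = (\<Sum>i = 1..n. ups A i + downs A i + 1)"
    unfolding mult_def sum.distrib by linarith
  also have "\<dots> = (\<Sum>i = 1..n. i)"
    by (rule sum.cong) (use ups_plus_downs in auto)
  finally show ?thesis
    using gauss_sum_from_Suc_0[of n, where 'a = nat] by (simp add: algebra_simps)
qed

text \<open>
  The product of the letters is an \<open>(n + 1)\<close>-cycle; \<open>label v\<close> is the place of \<open>v\<close> on that cycle,
  where the circle of length \<open>n + 1\<close> carries \<open>1\<close> at \<open>0\<close>, the upper points in increasing order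
  clockwise, and the lower points in increasing order counterclockwise.
\<close>

definition label :: "nat \<Rightarrow> int" where
  "label v =
     (if v = n + 1 then int (ups A n) + 1
      else if v = 1 \<or> A (v - 1) then int (ups A v)
      else int n + 1 - int (downs A v))"

text \<open>\<open>ups\<close> rises strictly at an upper point and \<open>downs\<close> at a lower
  point, and lower labels lie above all upper ones. Since all labels are in \<open>0..n\<close>,
  congruence modulo \<open>n + 1\<close> is equality.\<close>

lemma label_inj:
  assumes v: "1 \<le> v" "v \<le> n + 1" and v': "1 \<le> v'" "v' \<le> n + 1"
    and dvd: "int (n + 1) dvd label v - label v'"
  shows "v = v'"
proof -
  have up: "ups A u < ups A w" if "u < w" "A (w - 1)" "1 \<le> u" for u w
    using that ups_mono[of u "w - 1" A] ups_Suc[of "w - 1" A] by (cases w) auto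
  have down: "downs A u < downs A w" if "u < w" "\<not> A (w - 1)" "1 \<le> u" for u w
    using that downs_mono[of u "w - 1" A] downs_Suc[of "w - 1" A] by (cases w) auto
  have total: "ups A n + downs A n + 1 = n"
    using ups_plus_downs n_pos by blast
  have bounds: "0 \<le> label u \<and> label u < int (n + 1)" if "1 \<le> u" "u \<le> n + 1" for u
    using total ups_mono[of u n A] downs_mono[of u n A] that down[of 1 u]
    by (auto simp: label_def)
  have *: False if "u < w" "1 \<le> u" "w \<le> n + 1" "label u = label w" for u w
  proof -
    have "ups A u \<le> ups A n" "downs A w \<le> downs A n" if "w \<le> n"
      using ups_mono[of u n A] downs_mono[of w n A] that \<open>u < w\<close> by auto
    moreover have "ups A u \<le> ups A n" "downs A u \<le> downs A n"
      using ups_mono[of u n A] downs_mono[of u n A] that by auto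
    moreover have "ups A w \<le> ups A n" if "w \<le> n"
      using ups_mono[of w n A] that by auto
    ultimately show False
      using that total up[of u w] down[of u w] down[of 1 u] by (auto simp: label_def split: if_splits)
  qed
  have "\<bar>label v - label v'\<bar> < int (n + 1)"
    using bounds[OF v] bounds[OF v'] by linarith
  with dvd_imp_le_int[OF _ dvd] have "label v - label v' = 0"
    by linarith
  then show ?thesis
    using *[of v v'] *[of v' v] v v' by (cases v v' rule: linorder_cases) auto
qed

text \<open>
  \<open>j\<close> may be appended when its neighbours have occurred as often as they have in \<open>cw cw \<dots>\<close>,
  where \<open>A j\<close> means that \<open>j\<close> precedes \<open>j + 1\<close> in \<open>cw\<close>.
\<close>

inductive admissible :: "nat list \<Rightarrow> bool" where
  Nil: "admissible []"
| snoc: "\<lbrakk>admissible w; 1 \<le> j; j \<le> n;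
    1 < j \<Longrightarrow> count_list w (j - 1) = count_list w j + of_bool (A (j - 1));
    j < n \<Longrightarrow> count_list w (Suc j) = count_list w j + of_bool (\<not> A j)\<rbrakk>
    \<Longrightarrow> admissible (w @ [j])"

text \<open>The circle position, not reduced modulo \<open>n + 1\<close>, of the value at index
  \<open>j\<close> once each letter \<open>i\<close> has been used \<open>t i\<close> times. The
  letters \<open>j - 1\<close> and \<open>j\<close> alternate in an admissible word, and the test
  holds exactly when \<open>j - 1\<close> is the next of the two.\<close>

definition place :: "(nat \<Rightarrow> nat) \<Rightarrow> nat \<Rightarrow> int" where
  "place t j =
     (if j = n + 1 then int (ups A n) + 1 + int (t n)
      else if j = 1 then int (t 1)
      else if A (j - 1) = (t (j - 1) = t j) then int (ups A j) + int (t j)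
      else int (t j) - int (downs A j))"

text \<open>Appending \<open>j\<close> exchanges the values at \<open>j\<close> and
  \<open>j + 1\<close>, and the formula for \<open>place\<close> exchanges its two results
  accordingly. The congruence absorbs a full turn of \<open>n + 1\<close>, which appears at the
  start for lower points and after each letter \<open>n\<close>.\<close>

lemma admissible_place:
  assumes "admissible w" "1 \<le> v" "v \<le> n + 1"
  shows "int (n + 1) dvd label (perm_of w v) - place (count_list w) v"
  using assms
proof (induction w arbitrary: v)
  case Nil
  then show ?case
    by (auto simp: label_def place_def add.commute)
next
  case (snoc w j)
  let ?t = "count_list w" and ?t' = "count_list (w @ [j])"
  have t': "?t' i = (if i = j then ?t j + 1 else ?t i)" for i
    by simp
  have total: "ups A n + downs A n + 1 = n"
    using ups_plus_downs n_pos by blast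
  \<comment> \<open>Admissibility of \<open>j\<close> decides the branch of \<open>place\<close>:
    lower at \<open>j\<close>, upper at \<open>j + 1\<close>.\<close>
  have below: "place ?t j = int (?t j) - int (downs A j)"
    using snoc.hyps by (cases "j = 1"; cases "A (j - 1)") (auto simp: place_def)
  have above: "place ?t (Suc j) = int (ups A j) + int (?t j) + 1"
    using snoc.hyps by (cases "j = n"; cases "A j") (auto simp: place_def ups_Suc)
  have below': "place ?t' j = int (ups A j) + int (?t j) + 1"
    using snoc.hyps by (cases "j = 1"; cases "A (j - 1)") (auto simp: place_def t')
  have above': "int (n + 1) dvd place ?t' (Suc j) - (int (?t j) - int (downs A j))"
  proof (cases "j = n")
    case True
    then have "place ?t' (Suc j) - (int (?t j) - int (downs A j)) = int (n + 1)"
      using total by (simp add: place_def)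
    then show ?thesis
      by simp
  next
    case False
    then have "place ?t' (Suc j) = int (?t j) - int (downs A j)"
      using snoc.hyps by (cases "A j") (auto simp: place_def t' downs_Suc)
    then show ?thesis
      by simp
  qed
  consider "v = j" | "v = Suc j" | "v \<noteq> j" "v \<noteq> Suc j"
    by blast
  then show ?case
  proof cases
    case 1
    then show ?thesis
      using snoc.IH[of "Suc j"] snoc.hyps above below'
      by (simp add: perm_of_snoc adj_transp_apply del: count_list_append)
  next
    case 2
    have "int (n + 1) dvd label (perm_of w j) - place ?t j"
      using snoc.IH[of j] snoc.hyps by simp
    then have "int (n + 1) dvd (label (perm_of w j) - place ?t j)
        - (place ?t' (Suc j) - (int (?t j) - int (downs A j)))"
      using above' by (rule dvd_diff)
    then show ?thesis
      using 2 below by (simp add: perm_of_snoc adj_transp_apply del: count_list_append)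
  next
    case 3
    then have "place ?t' v = place ?t v"
      using snoc.hyps snoc.prems by (auto simp: place_def t')
    then show ?thesis
      using 3 snoc.IH[of v] snoc.prems
      by (simp add: perm_of_snoc adj_transp_apply del: count_list_append)
  qed
qed

lemma admissible_set: "admissible w \<Longrightarrow> set w \<subseteq> {1..n}"
  by (induction rule: admissible.induct) auto

text \<open>Stated for one index at a time because it is also applied to unfinished words, where
  only the letters next to \<open>v\<close> are used up. By the invariant it suffices to compare
  \<open>place\<close> with the label of \<open>n + 2 - v\<close>.\<close>

lemma perm_of_complete_admissible:
  assumes w: "admissible w" and v: "1 \<le> v" "v \<le> n + 1"
    and here: "v \<le> n \<Longrightarrow> count_list w v = mult v"
    and before: "1 < v \<Longrightarrow> count_list w (v - 1) = mult (v - 1)"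
  shows "perm_of w v = n + 2 - v"
proof -
  let ?t = "count_list w"
  have total: "ups A n + downs A n + 1 = n"
    using ups_plus_downs n_pos by blast
  have "int (n + 1) dvd place ?t v - label (n + 2 - v)"
  proof -
    consider "v = n + 1" | "v = 1" | "1 < v" "v \<le> n"
      using v by linarith
    then show ?thesis
    proof cases
      case 1
      then have "place ?t v - label (n + 2 - v) = int (n + 1)"
        using before n_pos total by (simp add: place_def label_def mult_def)
      then show ?thesis
        by simp
    next
      case 2
      then show ?thesis
        using here n_pos by (simp add: place_def label_def mult_def)
    next
      case 3
      define v' where "v' = n + 1 - v"
      have v': "1 \<le> v'" "v' < n" "n + 2 - v = Suc v'" "n - (v - 1) = v'" "n + 1 - v = v'"
        using 3 by (auto simp: v'_def)
      have sums: "ups A v + downs A v + 1 = v" "ups A v' + downs A v' + 1 = v'"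
        using ups_plus_downs 3 v' by auto
      have t: "?t v = mult v" "?t (v - 1) = mult (v - 1)"
        using here before 3 by auto
      \<comment> \<open>By \<open>mult_Suc\<close> the mirror edge \<open>v'\<close> alone decides
        the branch at \<open>v\<close>: the lower formula meets an upper label, the upper formula a
        lower one.\<close>
      have test: "A (v - 1) = (?t (v - 1) = ?t v) \<longleftrightarrow> \<not> A v'"
      proof -
        have "1 \<le> v - 1" "v - 1 < n" "Suc (v - 1) = v"
          using 3 by auto
        then show ?thesis
          using mult_Suc[of "v - 1"] v'(4) t by (cases "A (v - 1)"; cases "A v'") auto
      qed
      have m: "mult v = 1 + downs A v + ups A v'"
        using v' by (simp add: mult_def)
      show ?thesis
      proof (cases "A v'")
        case True
        then have "place ?t v = label (n + 2 - v)"
          using test t m 3 v' by (auto simp: place_def label_def ups_Suc)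
        then show ?thesis
          by simp
      next
        case False
        then have "place ?t v = int (ups A v) + int (mult v)"
          using test t 3 by (simp add: place_def)
        moreover have "label (n + 2 - v) = int n + 1 - int (downs A v') - 1"
          using False v' by (simp add: label_def downs_Suc)
        moreover have "v + v' = n + 1"
          using 3 by (simp add: v'_def)
        ultimately have "place ?t v = label (n + 2 - v)"
          using sums m by linarith
        then show ?thesis
          by simp
      qed
    qed
  qed
  moreover have "int (n + 1) dvd label (perm_of w v) - place ?t v"
    using admissible_place[OF w v] .
  ultimately have "int (n + 1) dvd label (perm_of w v) - label (n + 2 - v)"
    using dvd_add[of "int (n + 1)" "label (perm_of w v) - place ?t v"] by fastforce
  moreover have "perm_of w v \<in> {1..n + 1}"
    using permutes_in_image[OF perm_of_permutes[OF admissible_set[OF w]]] v by auto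
  ultimately show ?thesis
    using label_inj v by auto
qed

lemma perm_of_complete:
  assumes "admissible w" "\<And>i. 1 \<le> i \<Longrightarrow> i \<le> n \<Longrightarrow> count_list w i = mult i"
  shows "perm_of w = reversal n"
proof
  fix v
  show "perm_of w v = reversal n v"
  proof (cases "v \<in> {1..n + 1}")
    case True
    then show ?thesis
      using perm_of_complete_admissible[OF assms(1), of v] assms(2)
      by (auto simp: reversal_def)
  next
    case False
    then show ?thesis
      using perm_of_permutes[OF admissible_set[OF assms(1)]]
      by (auto simp: reversal_def permutes_def)
  qed
qed

end

section \<open>The truncated periodic word of a Coxeter word\<close>

locale coxeter_word =
  fixes n :: nat and cw :: "nat list"
  assumes n_pos: "1 \<le> n" and distinct_cw: "distinct cw" and set_cw: "set cw = {1..n}"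
begin

sublocale orientation n "\<lambda>j. pos_in cw j < pos_in cw (Suc j)"
  by unfold_locales (rule n_pos)

lemma length_cw: "length cw = n"
  using distinct_card[OF distinct_cw] by (simp add: set_cw)

lemma pos_in_nth: "p < n \<Longrightarrow> pos_in cw (cw ! p) = p"
  unfolding pos_in_def
  by (rule the_equality) (use distinct_cw in \<open>auto simp: length_cw nth_eq_iff_index_eq\<close>)

lemma pos_in_props:
  assumes "1 \<le> i" "i \<le> n"
  shows "pos_in cw i < n" "cw ! pos_in cw i = i"
proof -
  obtain p where "p < n" "cw ! p = i"
    using assms set_cw by (metis atLeastAtMost_iff in_set_conv_nth length_cw)
  then show "pos_in cw i < n" "cw ! pos_in cw i = i"
    using pos_in_nth by auto
qed

lemma pos_in_inj: "1 \<le> i \<Longrightarrow> i \<le> n \<Longrightarrow> 1 \<le> j \<Longrightarrow> j \<le> n \<Longrightarrow> pos_in cw i = pos_in cw j \<Longrightarrow> i = j"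
  by (metis pos_in_props(2))

lemma periodic_letter_range: "1 \<le> periodic_letter cw p" "periodic_letter cw p \<le> n"
proof -
  have "cw ! (p mod n) \<in> set cw"
    using n_pos by (simp add: length_cw)
  then show "1 \<le> periodic_letter cw p" "periodic_letter cw p \<le> n"
    by (auto simp: set_cw periodic_letter_def length_cw)
qed

lemma pos_in_periodic_letter: "pos_in cw (periodic_letter cw p) = p mod n"
  using n_pos by (simp add: periodic_letter_def length_cw pos_in_nth)

lemma ascents_below_eq: "ascents_below cw i = ups (\<lambda>j. pos_in cw j < pos_in cw (Suc j)) i"
  by (simp add: ascents_below_def ups_def)

lemma descents_below_eq:
  assumes "i \<le> n"
  shows "descents_below cw i = downs (\<lambda>j. pos_in cw j < pos_in cw (Suc j)) i"
proof -
  have "{j. 1 \<le> j \<and> j < i \<and> pos_in cw j > pos_in cw (j + 1)}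
      = {j. 1 \<le> j \<and> j < i \<and> \<not> pos_in cw j < pos_in cw (Suc j)}"
  proof (rule Collect_cong)
    fix j
    show "(1 \<le> j \<and> j < i \<and> pos_in cw j > pos_in cw (j + 1))
        = (1 \<le> j \<and> j < i \<and> \<not> pos_in cw j < pos_in cw (Suc j))"
    proof (cases "1 \<le> j \<and> j < i")
      case True
      then have "pos_in cw j \<noteq> pos_in cw (Suc j)"
        using pos_in_inj[of j "Suc j"] assms by auto
      then show ?thesis
        by auto
    qed auto
  qed
  then show ?thesis
    by (simp only: descents_below_def downs_def)
qed

text \<open>\<open>p div n\<close> is the number of copies of this letter read before position
  \<open>p\<close>, so exactly the first \<open>mult\<close> copies of each letter are kept.\<close>

definition kept :: "nat \<Rightarrow> bool" where
  "kept p \<longleftrightarrow> p div n < mult (periodic_letter cw p)"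

definition kept_word :: "nat \<Rightarrow> nat list" where
  "kept_word p = map (periodic_letter cw) (filter kept [0..<p])"

lemma kept_word_Suc:
  "kept_word (Suc p) = kept_word p @ (if kept p then [periodic_letter cw p] else [])"
  by (simp add: kept_word_def)

lemma count_kept_word:
  assumes i: "1 \<le> i" "i \<le> n"
  shows "count_list (kept_word p) i = min (mult i) (p div n + of_bool (pos_in cw i < p mod n))"
proof (induction p)
  case 0
  then show ?case
    by (simp add: kept_word_def)
next
  case (Suc p)
  have pos: "pos_in cw i < n"
    using pos_in_props i by blast
  \<comment> \<open>Whether or not reading \<open>p\<close> completes a round, the copies of
    \<open>i\<close> read so far are counted by the weak inequality.\<close>
  have advance: "Suc p div n + of_bool (pos_in cw i < Suc p mod n)
      = p div n + of_bool (pos_in cw i \<le> p mod n)"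
  proof (cases "Suc (p mod n) = n")
    case True
    then have "Suc p div n = Suc (p div n)" "Suc p mod n = 0"
      by (simp_all add: div_Suc mod_Suc)
    then show ?thesis
      using True pos by simp
  next
    case False
    then have "Suc p div n = p div n" "Suc p mod n = Suc (p mod n)"
      by (simp_all add: div_Suc mod_Suc)
    then show ?thesis
      by (simp add: less_Suc_eq_le)
  qed
  show ?case
  proof (cases "periodic_letter cw p = i")
    case True
    then have "pos_in cw i = p mod n"
      using pos_in_periodic_letter[of p] by simp
    then show ?thesis
      using Suc True unfolding advance by (auto simp: kept_word_Suc kept_def min_def)
  next
    case False
    then have "pos_in cw i \<noteq> p mod n"
      using pos_in_props[OF i] by (auto simp: periodic_letter_def length_cw)
    then show ?thesis
      using Suc False unfolding advance by (simp add: kept_word_Suc order_le_less)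
  qed
qed

text \<open>While a letter is still kept, \<open>mult_Suc\<close> makes the multiplicities of its
  neighbours large enough that their counts are not yet cut off below the required value.\<close>

lemma admissible_kept_word: "admissible (kept_word p)"
proof (induction p)
  case 0
  then show ?case
    using admissible.Nil by (simp add: kept_word_def)
next
  case (Suc p)
  define j where "j = periodic_letter cw p"
  have j: "1 \<le> j" "j \<le> n" "pos_in cw j = p mod n"
    using periodic_letter_range pos_in_periodic_letter by (auto simp: j_def)
  show ?case
  proof (cases "kept p")
    case True
    then have t: "p div n < mult j"
      by (simp add: kept_def j_def)
    have here: "count_list (kept_word p) j = p div n"
      using count_kept_word[of j p] j t by simp
    have "admissible (kept_word p @ [j])"
    proof (rule admissible.snoc[OF Suc j(1,2)])
      assume "1 < j"
      then have "mult j + of_bool (pos_in cw (n - (j - 1)) < pos_in cw (n - (j - 1) + 1))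
          = mult (j - 1) + of_bool (\<not> pos_in cw (j - 1) < pos_in cw j)"
        using mult_Suc[of "j - 1"] j by simp
      then show "count_list (kept_word p) (j - 1)
          = count_list (kept_word p) j + of_bool (pos_in cw (j - 1) < pos_in cw (Suc (j - 1)))"
        using t \<open>1 < j\<close> j here count_kept_word[of "j - 1" p]
        by (cases "pos_in cw (j - 1) < pos_in cw j") auto
    next
      assume "j < n"
      then have "mult (Suc j) + of_bool (pos_in cw (n - j) < pos_in cw (n - j + 1))
          = mult j + of_bool (\<not> pos_in cw j < pos_in cw (Suc j))"
        using mult_Suc[of j] j by simp
      moreover have "pos_in cw j \<noteq> pos_in cw (Suc j)"
        using pos_in_inj[of j "Suc j"] j \<open>j < n\<close> by auto
      ultimately show "count_list (kept_word p) (Suc j)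
          = count_list (kept_word p) j + of_bool (\<not> pos_in cw j < pos_in cw (Suc j))"
        using t \<open>j < n\<close> j here count_kept_word[of "Suc j" p]
        by (cases "pos_in cw j < pos_in cw (Suc j)"; cases "pos_in cw (n - j) < pos_in cw (n - j + 1)") auto
    qed
    then show ?thesis
      using True by (simp add: kept_word_Suc j_def)
  next
    case False
    then show ?thesis
      using Suc by (simp add: kept_word_Suc)
  qed
qed

text \<open>A skipped letter \<open>j\<close> is used up, and by \<open>mult_Suc\<close> so are its
  neighbours. The indices \<open>j\<close> and \<open>j + 1\<close> then already carry their values
  in the reversal, which decrease.\<close>

lemma skipped_letter_descends:
  assumes "\<not> kept p"
  shows "perm_of (kept_word p) (Suc (periodic_letter cw p)) < perm_of (kept_word p) (periodic_letter cw p)"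
proof -
  define j where "j = periodic_letter cw p"
  have j: "1 \<le> j" "j \<le> n" "pos_in cw j = p mod n"
    using periodic_letter_range pos_in_periodic_letter by (auto simp: j_def)
  have t: "mult j \<le> p div n"
    using assms by (simp add: kept_def j_def)
  have here: "count_list (kept_word p) j = mult j"
    using count_kept_word[of j p] j t by simp
  have before: "count_list (kept_word p) (j - 1) = mult (j - 1)" if "1 < j"
  proof -
    have "mult j + of_bool (pos_in cw (n - (j - 1)) < pos_in cw (n - (j - 1) + 1))
        = mult (j - 1) + of_bool (\<not> pos_in cw (j - 1) < pos_in cw j)"
      using mult_Suc[of "j - 1"] j that by simp
    then show ?thesis
      using t that j count_kept_word[of "j - 1" p]
      by (cases "pos_in cw (j - 1) < pos_in cw j";
          cases "pos_in cw (n - (j - 1)) < pos_in cw (n - (j - 1) + 1)") auto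
  qed
  have after: "count_list (kept_word p) (Suc j) = mult (Suc j)" if "j < n"
  proof -
    have "mult (Suc j) + of_bool (pos_in cw (n - j) < pos_in cw (n - j + 1))
        = mult j + of_bool (\<not> pos_in cw j < pos_in cw (Suc j))"
      using mult_Suc[of j] j that by simp
    moreover have "pos_in cw j \<noteq> pos_in cw (Suc j)"
      using pos_in_inj[of j "Suc j"] j that by auto
    ultimately show ?thesis
      using t that j count_kept_word[of "Suc j" p]
      by (cases "pos_in cw j < pos_in cw (Suc j)"; cases "pos_in cw (n - j) < pos_in cw (n - j + 1)") auto
  qed
  have "perm_of (kept_word p) j = n + 2 - j" "perm_of (kept_word p) (Suc j) = n + 2 - Suc j"
    using perm_of_complete_admissible[OF admissible_kept_word, of j p]
      perm_of_complete_admissible[OF admissible_kept_word, of "Suc j" p] here before after j by auto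
  then show ?thesis
    using j by (simp flip: j_def)
qed

lemma count_full_word:
  assumes "1 \<le> i" "i \<le> n"
  shows "count_list (kept_word (n * n)) i = mult i"
  using count_kept_word[OF assms, of "n * n"] mult_le[OF assms] n_pos by simp

lemma perm_of_full_word: "perm_of (kept_word (n * n)) = reversal n"
  using perm_of_complete[OF admissible_kept_word] count_full_word by blast

end

section \<open>Sorting words and the rotation\<close>

lemma cox_length_le:
  "set ws \<subseteq> {1..n} \<Longrightarrow> word_prod G s ws = x \<Longrightarrow> cox_length G s n x \<le> length ws"
  unfolding cox_length_def by (rule Least_le) blast

lemma exists_shortest_word:
  assumes "set ws \<subseteq> {1..n}" "word_prod G s ws = x"
  shows "\<exists>u. set u \<subseteq> {1..n} \<and> length u = cox_length G s n x \<and> word_prod G s u = x"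
  unfolding cox_length_def
  by (rule LeastI_ex[of "\<lambda>l. \<exists>u. set u \<subseteq> {1..n} \<and> length u = l \<and> word_prod G s u = x"])
    (use assms in blast)

text \<open>Asymmetry of the lexicographic order supplies the uniqueness required by the definite
  description.\<close>

lemma sorting_word_eqI:
  assumes ps: "longest_subword G s n cw ps"
    and first: "\<And>qs. longest_subword G s n cw qs \<Longrightarrow> ps \<noteq> qs \<Longrightarrow> (ps, qs) \<in> lexord less_than"
  shows "sorting_word G s n cw = map (periodic_letter cw) ps"
proof -
  have asym: "asym (lexord less_than)"
    by (rule lexord_asym) (simp add: asym_less_than)
  have "(THE ps. longest_subword G s n cw ps \<and>
      (\<forall>qs. longest_subword G s n cw qs \<longrightarrow> ps = qs \<or> (ps, qs) \<in> lexord less_than)) = ps"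
  proof (rule the_equality)
    fix qs
    assume qs: "longest_subword G s n cw qs \<and>
      (\<forall>rs. longest_subword G s n cw rs \<longrightarrow> qs = rs \<or> (qs, rs) \<in> lexord less_than)"
    show "qs = ps"
    proof (rule ccontr)
      assume "qs \<noteq> ps"
      then have "(ps, qs) \<in> lexord less_than" "(qs, ps) \<in> lexord less_than"
        using qs ps first by auto
      with asym show False
        by (meson asymD)
    qed
  qed (use ps first in blast)
  then show ?thesis
    by (simp add: sorting_word_def)
qed

text \<open>At the first disagreement \<open>qs\<close> has the smaller entry \<open>b\<close>,
  which \<open>ps\<close> therefore skips; equal lengths exclude a proper prefix. The entry
  \<open>a\<close> of \<open>ps\<close> bounds \<open>b\<close> from above.\<close>

lemma sorted_lists_first_difference:
  assumes "sorted_wrt (<) ps" "sorted_wrt (<) qs" "length ps = length qs" "ps \<noteq> qs"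
    "(ps, qs) \<notin> lexord less_than"
  obtains u b v a where "qs = u @ b # v" "u = filter (\<lambda>x. x < b) ps" "b \<notin> set ps" "a \<in> set ps" "b < (a :: nat)"
proof -
  have "\<exists>u b v a. qs = u @ b # v \<and> u = filter (\<lambda>x. x < b) ps \<and> b \<notin> set ps \<and> a \<in> set ps \<and> b < a"
    using assms(3,1,2,4,5)
  proof (induction ps qs rule: list_induct2)
    case (Cons x xs y ys)
    show ?case
    proof (cases "x = y")
      case True
      with Cons obtain u b v a where *: "ys = u @ b # v" "u = filter (\<lambda>x. x < b) xs" "b \<notin> set xs"
        "a \<in> set xs" "b < a"
        by auto
      moreover have "y < b"
        using Cons.prems(2) * by auto
      ultimately show ?thesis
        using True by (intro exI[of _ "y # u"] exI[of _ b] exI[of _ v] exI[of _ a]) auto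
    next
      case False
      with Cons.prems have "y < x"
        by auto
      moreover from this Cons.prems(1) have "\<forall>z\<in>set xs. y < z"
        by auto
      ultimately show ?thesis
        by (intro exI[of _ "[]"] exI[of _ y] exI[of _ ys] exI[of _ x])
          (force simp: filter_empty_conv eq_commute[of "[]"])
    qed
  qed simp
  with that show ?thesis
    by blast
qed

lemma count_list_conv_card: "count_list Q i = card {j. j < length Q \<and> Q ! j = i}"
  by (simp add: count_list_eq_length_filter length_filter_conv_card eq_commute)

lemma occurrence_pos: "1 \<le> occurrence Q q"
proof -
  have "card {q} \<le> occurrence Q q"
    unfolding occurrence_def by (rule card_mono) auto
  then show ?thesis
    by simp
qed

text \<open>
  After the last occurrence of a letter, \<open>\<Theta>\<close> restarts at the first occurrence of the conjugate
  letter, so only the total number of occurrences of each letter matters.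
\<close>

lemma Theta_rotates:
  assumes q: "q < length Q"
    and inj: "inj_on s (set Q)"
    and dual: "\<And>i. i \<in> set Q \<Longrightarrow> dual i \<in> set Q \<and> psi G s n (s i) = s (dual i)"
    and base: "\<And>i. i \<in> set Q \<Longrightarrow> base (dual i) = (rot ^^ count_list Q i) (base i)"
    and phi: "\<And>q. phi q = (rot ^^ (occurrence Q q - 1)) (base (Q ! q))"
  shows "phi (Theta G s n Q q) = rot (phi q)"
proof -
  define r where "r = Theta G s n Q q"
  have occ: "occurrence Q q = Suc (occurrence Q q - 1)"
    using occurrence_pos[of Q q] by simp
  have "(rot ^^ (occurrence Q r - 1)) (base (Q ! r)) = (rot ^^ occurrence Q q) (base (Q ! q))"
  proof (cases "\<exists>j. q < j \<and> j < length Q \<and> Q ! j = Q ! q")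
    case True
    then have r: "r = (LEAST j. q < j \<and> j < length Q \<and> Q ! j = Q ! q)"
      by (simp add: r_def Theta_def)
    have next_r: "q < r" "Q ! r = Q ! q"
      using LeastI_ex[OF True] by (auto simp: r)
    have least: "r \<le> j" if "q < j" "j < length Q" "Q ! j = Q ! q" for j
      unfolding r by (rule Least_le) (use that in blast)
    have "r < length Q"
      using LeastI_ex[OF True] by (auto simp: r)
    have "{j. j \<le> r \<and> Q ! j = Q ! r} = insert r {j. j \<le> q \<and> Q ! j = Q ! q}"
    proof (intro equalityI subsetI)
      fix j
      assume "j \<in> {j. j \<le> r \<and> Q ! j = Q ! r}"
      then have j: "j \<le> r" "Q ! j = Q ! q"
        using next_r by auto
      then have "r \<le> j" if "q < j"
        using least[of j] that \<open>r < length Q\<close> by simp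
      then show "j \<in> insert r {j. j \<le> q \<and> Q ! j = Q ! q}"
        using j by force
    qed (use next_r in auto)
    moreover have "r \<notin> {j. j \<le> q \<and> Q ! j = Q ! q}"
      using next_r by simp
    ultimately have "occurrence Q r = Suc (occurrence Q q)"
      by (simp add: occurrence_def)
    then show ?thesis
      using next_r by simp
  next
    case False
    define i' where "i' = dual (Q ! q)"
    have i': "i' \<in> set Q" "psi G s n (s (Q ! q)) = s i'"
      using dual[of "Q ! q"] q by (auto simp: i'_def)
    \<comment> \<open>\<open>Theta\<close> compares generators while occurrences compare indices;
      injectivity on the letters of \<open>Q\<close> identifies the two searches.\<close>
    have "s (Q ! j) = s i' \<longleftrightarrow> Q ! j = i'" if "j < length Q" for j
      using inj i'(1) that by (auto simp: inj_on_eq_iff)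
    then have "r = (LEAST j. j < length Q \<and> Q ! j = i')"
      using False i'(2) by (simp add: r_def Theta_def cong: conj_cong)
    moreover have ex: "\<exists>j. j < length Q \<and> Q ! j = i'"
      using i'(1) by (auto simp: in_set_conv_nth)
    ultimately have r: "r < length Q" "Q ! r = i'" "\<And>j. j < length Q \<Longrightarrow> Q ! j = i' \<Longrightarrow> r \<le> j"
      using LeastI_ex[OF ex] by (auto intro: Least_le)
    have "{j. j \<le> r \<and> Q ! j = Q ! r} = {r}"
      using r by (auto intro: le_antisym)
    then have first: "occurrence Q r = 1"
      by (simp add: occurrence_def)
    have "{j. j \<le> q \<and> Q ! j = Q ! q} = {j. j < length Q \<and> Q ! j = Q ! q}"
      using False q by (auto simp: not_less[symmetric])
    then have "occurrence Q q = count_list Q (Q ! q)"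
      by (simp add: occurrence_def count_list_conv_card)
    then show ?thesis
      using first r(2) base[of "Q ! q"] q by (simp add: i'_def)
  qed
  also have "\<dots> = rot ((rot ^^ (occurrence Q q - 1)) (base (Q ! q)))"
    using occ by (metis comp_apply funpow.simps(2))
  finally show ?thesis
    by (simp add: phi flip: r_def)
qed

lemma count_list_concat_replicate: "count_list (concat (replicate k w)) i = k * count_list w i"
  by (induction k) auto

lemma (in coxeter_word) count_cw:
  assumes "1 \<le> i" "i \<le> n"
  shows "count_list cw i = 1"
proof -
  have "{j. j < length cw \<and> cw ! j = i} = {pos_in cw i}"
    using pos_in_props[OF assms] pos_in_nth by (auto simp: length_cw)
  then show ?thesis
    by (simp add: count_list_conv_card)
qed

section \<open>Type A\<close>

lemma cox_length_sym_group:
  assumes "f permutes {1..n + 1}"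
  shows "cox_length (sym_group (n + 1)) adj_transp n f = card (inversions n f)"
  unfolding cox_length_def word_prod_sym_group
proof (rule Least_equality)
  show "\<exists>ws. set ws \<subseteq> {1..n} \<and> length ws = card (inversions n f) \<and> perm_of ws = f"
    by (rule exists_word_of_inversions[OF assms])
qed (use card_inversions_perm_of in blast)

text \<open>Length counts inversions, and the reversal is the only permutation that inverts all
  pairs.\<close>

lemma longest_element_sym_group: "longest_element (sym_group (n + 1)) adj_transp n = reversal n"
  unfolding longest_element_def
proof (rule the_equality)
  have le: "card (inversions n f) \<le> card (index_pairs n)" for f
    by (rule card_mono[OF finite_index_pairs inversions_subset])
  show "reversal n \<in> carrier (sym_group (n + 1)) \<and> (\<forall>x\<in>carrier (sym_group (n + 1)).
      cox_length (sym_group (n + 1)) adj_transp n x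
        \<le> cox_length (sym_group (n + 1)) adj_transp n (reversal n))"
    using reversal_permutes[of n] le
    by (simp add: sym_group_carrier cox_length_sym_group[simplified] inversions_reversal)
  fix w
  assume w: "w \<in> carrier (sym_group (n + 1)) \<and> (\<forall>x\<in>carrier (sym_group (n + 1)).
      cox_length (sym_group (n + 1)) adj_transp n x \<le> cox_length (sym_group (n + 1)) adj_transp n w)"
  then have perm: "w permutes {1..n + 1}"
    by (simp add: sym_group_carrier)
  have "card (index_pairs n) \<le> card (inversions n w)"
    using w reversal_permutes[of n] cox_length_sym_group[OF perm]
      cox_length_sym_group[OF reversal_permutes] by (metis inversions_reversal sym_group_carrier)
  then have "inversions n w = index_pairs n"
    by (intro card_seteq[OF finite_index_pairs inversions_subset])
  with perm show "w = reversal n"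
    by (rule all_inversions_imp_reversal)
qed

lemma psi_sym_group:
  assumes "1 \<le> i" "i \<le> n"
  shows "psi (sym_group (n + 1)) adj_transp n (adj_transp i) = adj_transp (n + 1 - i)"
proof -
  interpret group "sym_group (n + 1)"
    by (rule sym_group_is_group)
  have "reversal n \<circ> reversal n = id"
    by (rule ext) simp
  then have "inv\<^bsub>sym_group (n + 1)\<^esub> reversal n = reversal n"
    by (intro inv_equality)
      (use reversal_permutes[of n] in \<open>simp_all add: sym_group_mult sym_group_one sym_group_carrier\<close>)
  then have "psi (sym_group (n + 1)) adj_transp n (adj_transp i)
      = reversal n \<circ> adj_transp i \<circ> reversal n"
    by (simp only: psi_def longest_element_sym_group sym_group_mult)
  also have "\<dots> = adj_transp (n + 1 - i)"
  proof
    fix a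
    have "(reversal n \<circ> adj_transp i \<circ> reversal n) a
        = reversal n (reversal n (adj_transp (n + 1 - i) a))"
      unfolding comp_apply adj_transp_reversal[OF assms] ..
    then show "(reversal n \<circ> adj_transp i \<circ> reversal n) a = adj_transp (n + 1 - i) a"
      by (simp only: reversal_involutory)
  qed
  finally show ?thesis .
qed

text \<open>The support argument puts every letter into \<open>cw\<close>, and minimality bounds its
  length by \<open>n\<close>, so no letter repeats.\<close>

lemma coxeter_word_sym_group:
  assumes "1 \<le> n" "coxeter_element (sym_group (n + 1)) adj_transp n c"
    "reduced_word (sym_group (n + 1)) adj_transp n cw c"
  shows "coxeter_word n cw"
proof -
  obtain ws where ws: "distinct ws" "set ws = {1..n}" "perm_of ws = c"
    using assms(2) by (auto simp: coxeter_element_def word_prod_sym_group)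
  have cw: "set cw \<subseteq> {1..n}" "perm_of cw = c"
    "length cw = cox_length (sym_group (n + 1)) adj_transp n c"
    using assms(3) by (auto simp: reduced_word_def word_prod_sym_group)
  have "{1..n} \<subseteq> set cw"
    using perm_of_single_letter_needed[of cw ws] ws cw by blast
  with cw have set_cw: "set cw = {1..n}"
    by blast
  have "length cw \<le> length ws"
    unfolding cw by (rule cox_length_le) (use ws in \<open>auto simp: word_prod_sym_group\<close>)
  also have "\<dots> = n"
    using distinct_card[OF ws(1)] ws(2) by simp
  finally have "distinct cw"
    using set_cw by (intro card_distinct) (metis card_atLeastAtMost card_length diff_Suc_1 le_antisym)
  with assms(1) set_cw show ?thesis
    by unfold_locales auto
qed

context coxeter_word
begin

text \<open>With this length the kept word is a reduced word for the reversal.\<close>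

lemma length_full_word: "length (kept_word (n * n)) = card (index_pairs n)"
proof -
  have set: "set (kept_word (n * n)) \<subseteq> {1..n}"
    by (rule admissible_set[OF admissible_kept_word])
  have "length (kept_word (n * n)) = (\<Sum>i = 1..n. count_list (kept_word (n * n)) i)"
    using sum_count_set[OF set] by simp
  also have "\<dots> = (\<Sum>i = 1..n. mult i)"
    by (rule sum.cong) (use count_full_word in auto)
  finally show ?thesis
    using sum_mult card_index_pairs[of n] by simp
qed

text \<open>An earlier competitor agrees with the kept positions up to a skipped position
  \<open>b\<close> and then uses \<open>b\<close>. That letter destroys an inversion, and the
  remaining letters are too few to invert all pairs.\<close>

lemma sorting_word_sym_group: "sorting_word (sym_group (n + 1)) adj_transp n cw = kept_word (n * n)"
proof -
  let ?G = "sym_group (n + 1)"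
  have sub: "longest_subword ?G adj_transp n cw qs \<longleftrightarrow>
      sorted_wrt (<) qs \<and> perm_of (map (periodic_letter cw) qs) = reversal n
        \<and> length qs = card (index_pairs n)" for qs
  proof -
    have "set (map (periodic_letter cw) qs) \<subseteq> {1..n}"
      using periodic_letter_range by auto
    then show ?thesis
      unfolding longest_subword_def reduced_word_def longest_element_sym_group word_prod_sym_group
        cox_length_sym_group[OF reversal_permutes] inversions_reversal length_map by blast
  qed
  let ?ps = "filter kept [0..<n * n]"
  have ps: "longest_subword ?G adj_transp n cw ?ps"
    using length_full_word perm_of_full_word
    unfolding sub by (simp add: sorted_wrt_filter kept_word_def)
  show ?thesis
    unfolding kept_word_def
  proof (rule sorting_word_eqI[OF ps], rule ccontr)
    fix qs
    assume qs: "longest_subword ?G adj_transp n cw qs" and "?ps \<noteq> qs" "(?ps, qs) \<notin> lexord less_than"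
    then obtain u b v a where split: "qs = u @ b # v" and u: "u = filter (\<lambda>x. x < b) ?ps"
      and b: "b \<notin> set ?ps" "a \<in> set ?ps" "b < a"
      using sorted_lists_first_difference[of ?ps qs] ps by (metis sub)
    have skip: "\<not> kept b" and bound: "b < n * n"
      using b by auto
    have "filter (\<lambda>x. x < b) [0..<n * n] = [0..<b]"
    proof -
      have "[0..<n * n] = [0..<b] @ [b..<n * n]"
        using bound by (metis le0 less_imp_le upt_add_eq_append le_add_diff_inverse)
      then show ?thesis
        by (simp add: filter_id_conv)
    qed
    moreover have "u = filter kept (filter (\<lambda>x. x < b) [0..<n * n])"
      by (simp add: u conj_commute)
    ultimately have u: "map (periodic_letter cw) u = kept_word b"
      by (simp add: kept_word_def)
    let ?i = "periodic_letter cw b" and ?w = "kept_word b"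
    let ?v = "map (periodic_letter cw) v"
    have desc: "card (inversions n (perm_of ?w)) = card (inversions n (perm_of (?w @ [?i]))) + 1"
      unfolding perm_of_snoc using skipped_letter_descends[OF skip] periodic_letter_range
      by (intro card_inversions_swap_descent) auto
    have "card (index_pairs n) = card (inversions n (perm_of ((?w @ [?i]) @ ?v)))"
      using qs unfolding sub by (simp add: split u inversions_reversal)
    also have "\<dots> \<le> card (inversions n (perm_of (?w @ [?i]))) + length ?v"
      by (rule card_inversions_append) (use periodic_letter_range in auto)
    also have "\<dots> < card (inversions n (perm_of ?w)) + length ?v + 1"
      unfolding desc by simp
    also have "\<dots> \<le> length ?w + length ?v + 1"
      using card_inversions_perm_of[OF admissible_set[OF admissible_kept_word]] by simp
    also have "\<dots> = length qs"
      by (simp add: split flip: u)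
    finally show False
      using qs unfolding sub by simp
  qed
qed

end

lemma rotate_cw_diagonal: "(rotate_cw N ^^ l) (diagonal N a b) = diagonal N (a + int l) (b + int l)"
proof (induction l)
  case (Suc l)
  then show ?case
    by (simp add: rotate_cw_def diagonal_def mod_add_left_eq mod_add_right_eq ac_simps)
qed simp

text \<open>Endpoints are matched crosswise: after all its rotations the diagonal of
  \<open>i\<close> is the first diagonal of the dual letter with its ends exchanged.\<close>

lemma diagonal_cong: "a mod int N = b' mod int N \<Longrightarrow> b mod int N = a' mod int N \<Longrightarrow> diagonal N a b = diagonal N a' b'"
  by (auto simp: diagonal_def)

text \<open>The letter \<open>i\<close> occurs \<open>k + mult i\<close> times in \<open>Q\<close>,
  and rotating its first diagonal that often gives the first diagonal of \<open>n + 1 - i\<close>,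
  as \<open>Theta_rotates\<close> requires.\<close>

lemma Theta_rotates_A:
  assumes m: "2 * k + 2 \<le> m" "n = m - 2 * k - 1"
    and c: "coxeter_element (sym_group (n + 1)) adj_transp n c"
      "reduced_word (sym_group (n + 1)) adj_transp n cw c"
    and Q: "Q = Q_word (sym_group (n + 1)) adj_transp n k cw"
    and q: "q < length Q"
  shows "phi_A k m cw Q (Theta (sym_group (n + 1)) adj_transp n Q q) = rotate_cw m (phi_A k m cw Q q)"
proof -
  interpret coxeter_word n cw
    using coxeter_word_sym_group[OF _ c] m by simp
  have Q: "Q = concat (replicate k cw) @ kept_word (n * n)"
    unfolding Q Q_word_def sorting_word_sym_group ..
  have count: "count_list Q i = k + mult i" if "1 \<le> i" "i \<le> n" for i
    using that by (simp add: Q count_list_concat_replicate count_cw count_full_word)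
  have set_Q: "set Q = {1..n}"
  proof
    show "set Q \<subseteq> {1..n}"
      using admissible_set[OF admissible_kept_word] by (auto simp: Q set_cw)
    show "{1..n} \<subseteq> set Q"
    proof
      fix i
      assume "i \<in> {1..n}"
      then have "count_list Q i \<noteq> 0"
        using count by (simp add: mult_def)
      then show "i \<in> set Q"
        by (metis count_notin)
    qed
  qed
  define base where
    "base i = diagonal m (int (ascents_below cw i)) (- int k - 1 - int (descents_below cw i))" for i
  show ?thesis
  proof (rule Theta_rotates[OF q, where dual = "\<lambda>i. n + 1 - i" and base = base])
    show "inj_on adj_transp (set Q)"
    proof (rule inj_onI)
      fix i j
      assume "adj_transp i = adj_transp j"
      then have "adj_transp i i = adj_transp j i" "adj_transp i j = adj_transp j j"
        by simp_all
      then show "i = j"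
        by (auto simp: adj_transp_apply split: if_splits)
    qed
    show "n + 1 - i \<in> set Q \<and> psi (sym_group (n + 1)) adj_transp n (adj_transp i) = adj_transp (n + 1 - i)"
      if "i \<in> set Q" for i
      using that psi_sym_group[of i n] by (auto simp: set_Q)
    show "phi_A k m cw Q q = (rotate_cw m ^^ (occurrence Q q - 1)) (base (Q ! q))" for q
      by (simp add: phi_A_def base_def Let_def)
    fix i
    assume "i \<in> set Q"
    then have i: "1 \<le> i" "i \<le> n"
      by (auto simp: set_Q)
    define i' where "i' = n + 1 - i"
    have i': "1 \<le> i'" "i' \<le> n" "i + i' = n + 1"
      using i by (auto simp: i'_def)
    let ?A = "\<lambda>j. pos_in cw j < pos_in cw (Suc j)"
    have sums: "ups ?A i + downs ?A i + 1 = i" "ups ?A i' + downs ?A i' + 1 = i'"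
      using ups_plus_downs i(1) i'(1) by blast+
    have c: "count_list Q i = k + 1 + downs ?A i + ups ?A i'"
      using count[OF i] by (simp add: mult_def i'_def)
    have m': "int m = int n + 2 * int k + 1"
      using m by simp
    \<comment> \<open>This end meets its counterpart after one full turn
      \<open>m = n + 2 * k + 1\<close>; the other end meets its counterpart exactly.\<close>
    have "int (ups ?A i) + int (count_list Q i) = - int k - 1 - int (downs ?A i') + int m"
      using sums i'(3) unfolding c m' by simp
    then have "(int (ups ?A i) + int (count_list Q i)) mod int m = (- int k - 1 - int (downs ?A i')) mod int m"
      by simp
    moreover have "- int k - 1 - int (downs ?A i) + int (count_list Q i) = int (ups ?A i')"
      unfolding c by simp
    ultimately show "base (n + 1 - i) = (rotate_cw m ^^ count_list Q i) (base i)"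
      unfolding base_def rotate_cw_diagonal i'_def[symmetric]
        ascents_below_eq descents_below_eq[OF i(2)] descents_below_eq[OF i'(2)]
      by (intro diagonal_cong[symmetric]) simp_all
  qed
qed

section \<open>A normal form in type B\<close>

text \<open>
  Every element is a product of initial segments of the words \<open>m \<dots> 2 1 2 \<dots> m\<close>, one for each
  \<open>m \<le> n\<close>. This bounds the length by \<open>n\<^sup>2\<close> and leaves a single candidate for the longest element.
\<close>

abbreviation equiv_B :: "nat \<Rightarrow> nat list \<Rightarrow> nat list \<Rightarrow> bool" where
  "equiv_B \<equiv> cox_equiv cox_matrix_B"

section \<open>Calculation with words modulo Coxeter relations\<close>

lemma cox_equiv_context:
  assumes "cox_equiv M n u v" "set x \<subseteq> {1..n}" "set y \<subseteq> {1..n}"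
  shows "cox_equiv M n (x @ u @ y) (x @ v @ y)"
  using assms(1)
proof induction
  case (rel i j u v)
  then show ?case
    using cox_equiv.rel[of i n j "x @ u" "v @ y" M] assms(2,3) by simp
qed (blast intro: cox_equiv.intros)+

lemma cox_equiv_cancel_rev:
  assumes "\<And>i. i \<in> {1..n} \<Longrightarrow> M i i = 1" "set w \<subseteq> {1..n}"
  shows "cox_equiv M n (w @ rev w) []"
  using assms(2)
proof (induction w rule: rev_induct)
  case (snoc i w)
  then have "cox_equiv M n (w @ [i, i] @ rev w) (w @ rev w)"
    using cox_equiv.rel[of i n i w "rev w" M] assms(1) by simp
  with snoc show ?case
    by (auto intro: cox_equiv.trans)
qed (simp add: cox_equiv.refl)

text \<open>Letters are involutions, so \<open>rev y\<close> inverts \<open>y\<close>; this turns a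
  defining relation into a commutation or braid rule.\<close>

lemma cox_equiv_solve:
  assumes "\<And>i. i \<in> {1..n} \<Longrightarrow> M i i = 1" "cox_equiv M n (x @ y) []"
    "set x \<subseteq> {1..n}" "set y \<subseteq> {1..n}"
  shows "cox_equiv M n x (rev y)"
proof -
  have "cox_equiv M n (x @ (y @ rev y) @ []) (x @ [] @ [])"
    by (rule cox_equiv_context[OF cox_equiv_cancel_rev]) (use assms in auto)
  moreover have "cox_equiv M n ([] @ (x @ y) @ rev y) ([] @ [] @ rev y)"
    by (rule cox_equiv_context) (use assms in auto)
  ultimately show ?thesis
    by (auto intro: cox_equiv.trans cox_equiv.sym)
qed

lemma cox_matrix_B_diag: "cox_matrix_B i i = 1"
  by (simp add: cox_matrix_B_def)

lemma equiv_B_cancel: "i \<in> {1..n} \<Longrightarrow> equiv_B n [i, i] []"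
  using cox_equiv_cancel_rev[of n cox_matrix_B "[i]"] by (simp add: cox_matrix_B_diag)

lemma equiv_B_commute:
  assumes "i \<in> {1..n}" "j \<in> {1..n}" "i + 1 < j \<or> j + 1 < i"
  shows "equiv_B n [i, j] [j, i]"
proof -
  have "cox_matrix_B i j = 2"
    using assms by (auto simp: cox_matrix_B_def doubleton_eq_iff)
  then have "equiv_B n ([i, j] @ [i, j]) []"
    using cox_equiv.rel[of i n j "[]" "[]" cox_matrix_B] assms by (simp add: numeral_eq_Suc)
  then show ?thesis
    using cox_equiv_solve[of n cox_matrix_B "[i, j]" "[i, j]"] assms by (simp add: cox_matrix_B_diag)
qed

lemma equiv_B_braid:
  assumes "2 \<le> i" "Suc i \<le> n"
  shows "equiv_B n [i, Suc i, i] [Suc i, i, Suc i]"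
proof -
  have "cox_matrix_B i (Suc i) = 3"
    using assms by (auto simp: cox_matrix_B_def doubleton_eq_iff)
  then have "equiv_B n ([i, Suc i, i] @ [Suc i, i, Suc i]) []"
    using cox_equiv.rel[of i n "Suc i" "[]" "[]" cox_matrix_B] assms by (simp add: numeral_eq_Suc)
  then show ?thesis
    using cox_equiv_solve[of n cox_matrix_B "[i, Suc i, i]" "[Suc i, i, Suc i]"] assms
    by (simp add: cox_matrix_B_diag)
qed

lemma equiv_B_braid_4:
  assumes "2 \<le> n"
  shows "equiv_B n [2, 1, 2, 1] [1, 2, 1, 2]"
proof -
  have "cox_matrix_B 2 1 = 4"
    by (auto simp: cox_matrix_B_def doubleton_eq_iff)
  then have "equiv_B n ([2, 1, 2, 1] @ [2, 1, 2, 1]) []"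
    using cox_equiv.rel[of 2 n 1 "[]" "[]" cox_matrix_B] assms by (simp add: numeral_eq_Suc)
  then show ?thesis
    using cox_equiv_solve[of n cox_matrix_B "[2, 1, 2, 1]" "[2, 1, 2, 1]"] assms
    by (simp add: cox_matrix_B_diag)
qed

text \<open>The bound \<open>m - 2\<close> excludes \<open>m - 1\<close>, the only smaller letter
  that does not commute with \<open>m\<close>.\<close>

lemma equiv_B_commute_word:
  assumes "m \<in> {1..n}" "set w \<subseteq> {1..m - 2}"
  shows "equiv_B n (w @ [m]) (m # w)"
  using assms(2)
proof (induction w)
  case (Cons i w)
  have sub: "{1..m - 2} \<subseteq> {1..n}"
    using assms(1) by auto
  with Cons.prems have w: "set w \<subseteq> {1..n}"
    by (auto dest!: subset_trans[OF _ sub])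
  have i: "i \<in> {1..n}" "i + 1 < m"
    using assms(1) Cons.prems by auto
  have "equiv_B n ([i] @ (w @ [m]) @ []) ([i] @ (m # w) @ [])"
    by (rule cox_equiv_context[OF Cons.IH]) (use Cons.prems i in auto)
  moreover have "equiv_B n ([] @ [i, m] @ w) ([] @ [m, i] @ w)"
    by (rule cox_equiv_context[OF equiv_B_commute]) (use i w assms(1) in auto)
  ultimately show ?case
    by (auto intro: cox_equiv.trans)
qed (simp add: cox_equiv.refl)

section \<open>Zigzag words as coset representatives\<close>

fun zig :: "nat \<Rightarrow> nat list" where
  "zig 0 = []"
| "zig (Suc m) = (if m = 0 then [1] else Suc m # zig m @ [Suc m])"

lemma length_zig: "1 \<le> m \<Longrightarrow> length (zig m) = 2 * m - 1"
  by (induction m) auto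

lemma set_zig: "set (zig m) \<subseteq> {1..m}"
  by (induction m) auto

text \<open>As a signed permutation \<open>zig m\<close> changes the sign of coordinate
  \<open>m\<close>, which smaller generators fix. In the induction step the new case
  \<open>j = m\<close> needs two braid moves around a commutation, or the relation of order four if
  \<open>m = 1\<close>.\<close>

lemma zig_commute:
  assumes "m \<le> n" "1 \<le> j" "j < m"
  shows "equiv_B n (zig m @ [j]) (j # zig m)"
  using assms
proof (induction m)
  case (Suc m)
  let ?M = "Suc m"
  have m: "1 \<le> m" "?M \<in> {1..n}" "j \<in> {1..n}" "m \<in> {1..n}"
    using Suc.prems by auto
  have zig_M: "zig ?M = ?M # zig m @ [?M]"
    using m by simp
  have set: "set (zig m) \<subseteq> {1..n}"
    using set_zig[of m] Suc.prems by force
  show ?case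
  proof (cases "j < m")
    case True
    have "equiv_B n ((?M # zig m) @ [?M, j] @ []) ((?M # zig m) @ [j, ?M] @ [])"
      by (rule cox_equiv_context[OF equiv_B_commute]) (use m set True in auto)
    moreover have "equiv_B n ([?M] @ (zig m @ [j]) @ [?M]) ([?M] @ (j # zig m) @ [?M])"
      by (rule cox_equiv_context[OF Suc.IH]) (use Suc.prems m True in auto)
    moreover have "equiv_B n ([] @ [?M, j] @ zig m @ [?M]) ([] @ [j, ?M] @ zig m @ [?M])"
      by (rule cox_equiv_context[OF equiv_B_commute]) (use m set True in auto)
    ultimately show ?thesis
      unfolding zig_M by (simp del: zig.simps) (blast intro: cox_equiv.trans)
  next
    case False
    then have j: "j = m"
      using Suc.prems by simp
    show ?thesis
    proof (cases "m = 1")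
      case True
      then show ?thesis
        using equiv_B_braid_4[of n] Suc.prems unfolding j by (simp add: numeral_2_eq_2)
    next
      case False
      then obtain l where l: "m = Suc l" "1 \<le> l"
        using m by (cases m) auto
      have zig_m: "zig m = m # zig l @ [m]"
        using l by simp
      have set_l: "set (zig l) \<subseteq> {1..n}" "set (zig l) \<subseteq> {1..?M - 2}"
        using set_zig[of l] m l by force+
      have "equiv_B n ((?M # m # zig l) @ [m, ?M, m] @ []) ((?M # m # zig l) @ [?M, m, ?M] @ [])"
        by (rule cox_equiv_context[OF equiv_B_braid]) (use m l set_l in auto)
      moreover have "equiv_B n ([?M, m] @ (zig l @ [?M]) @ [m, ?M]) ([?M, m] @ (?M # zig l) @ [m, ?M])"
        by (rule cox_equiv_context[OF equiv_B_commute_word]) (use m set_l in auto)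
      moreover have "equiv_B n ([] @ [?M, m, ?M] @ zig l @ [m, ?M]) ([] @ [m, ?M, m] @ zig l @ [m, ?M])"
        by (rule cox_equiv_context[OF cox_equiv.sym[OF equiv_B_braid]]) (use m l set_l in auto)
      ultimately show ?thesis
        unfolding zig_M zig_m j by (simp del: zig.simps) (blast intro: cox_equiv.trans)
    qed
  qed
qed simp

text \<open>The prefixes of \<open>zig m\<close> serve as representatives of the cosets of the
  parabolic subgroup on \<open>1..m - 1\<close>; closure under right multiplication is what collects
  a word into normal form.\<close>

lemma zig_prefix_snoc:
  assumes "1 \<le> m" "m \<le> n" "1 \<le> j" "j \<le> m"
  shows "\<exists>v l'. set v \<subseteq> {1..m - 1} \<and> equiv_B n (take l (zig m) @ [j]) (v @ take l' (zig m))"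
  using assms
proof (induction m arbitrary: j l)
  case (Suc m)
  let ?M = "Suc m"
  let ?goal = "\<exists>v l'. set v \<subseteq> {1..?M - 1} \<and> equiv_B n (take l (zig ?M) @ [j]) (v @ take l' (zig ?M))"
  have goalI: ?goal if "set v \<subseteq> {1..m}" "equiv_B n (take l (zig ?M) @ [j]) (v @ take l' (zig ?M))" for v l'
    unfolding diff_Suc_1 using that by blast
  have M: "?M \<in> {1..n}" "j \<in> {1..n}"
    using Suc.prems by auto
  show ?goal
  proof (cases "m = 0")
    case True
    show ?goal
    proof (cases l)
      case 0
      then show ?thesis
        using True Suc.prems by (intro goalI[of "[]" 1]) (simp_all add: cox_equiv.refl)
    next
      case (Suc l0)
      then show ?thesis
        using True Suc.prems equiv_B_cancel[of 1 n] by (intro goalI[of "[]" 0]) simp_all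
    qed
  next
    case False
    then have m: "1 \<le> m" "m \<in> {1..n}"
      using Suc.prems by auto
    have zig_M: "zig ?M = ?M # zig m @ [?M]"
      using m by simp
    have len: "length (zig m) = 2 * m - 1"
      using length_zig m by simp
    have set: "set (zig m) \<subseteq> {1..n}"
      using set_zig[of m] Suc.prems by force
    \<comment> \<open>The empty prefix, the top letter followed by a prefix of the inner zigzag, and
      the complete zigzag.\<close>
    consider "l = 0" | l0 where "l = Suc l0" "l0 \<le> 2 * m - 1" | "2 * m < l"
      using m by (cases l) force+
    then show ?goal
    proof cases
      case 1
      show ?thesis
      proof (cases "j = ?M")
        case True
        then show ?thesis
          using 1 unfolding zig_M by (intro goalI[of "[]" 1, unfolded zig_M]) (simp_all add: cox_equiv.refl)
      next
        case False
        then show ?thesis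
          using 1 Suc.prems by (intro goalI[of "[j]" 0]) (simp_all add: cox_equiv.refl)
      qed
    next
      case 2
      then have take_l: "take l (zig ?M) = ?M # take l0 (zig m)"
        using len by (simp add: zig_M del: zig.simps)
      have take_Suc: "take (Suc l') (zig ?M) = ?M # take l' (zig m)" if "l' \<le> 2 * m - 1" for l'
        using len that by (simp add: zig_M del: zig.simps)
      show ?thesis
      proof (cases "j = ?M")
        case False
        then obtain v l' where v: "set v \<subseteq> {1..m - 1}"
          and IH: "equiv_B n (take l0 (zig m) @ [j]) (v @ take l' (zig m))"
          using Suc.IH[of j l0] Suc.prems m by auto
        let ?t = "take l' (zig m)"
        \<comment> \<open>Capping the length keeps the prefix inside the inner zigzag, so prepending
          the top letter gives a prefix of \<open>zig (Suc m)\<close>.\<close>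
        have t: "?t = take (min l' (2 * m - 1)) (zig m)"
          using len by (simp add: min_def)
        have set_t: "set ?t \<subseteq> {1..n}"
          by (rule subset_trans[OF set_take_subset set])
        have "equiv_B n ([?M] @ (take l0 (zig m) @ [j]) @ []) ([?M] @ (v @ ?t) @ [])"
          by (rule cox_equiv_context[OF IH]) (use M in auto)
        moreover have "equiv_B n ([] @ (?M # v) @ ?t) ([] @ (v @ [?M]) @ ?t)"
          by (rule cox_equiv_context[OF cox_equiv.sym[OF equiv_B_commute_word]])
            (use M v set_t in auto)
        ultimately have "equiv_B n (take l (zig ?M) @ [j]) (v @ take (Suc (min l' (2 * m - 1))) (zig ?M))"
          using take_Suc[of "min l' (2 * m - 1)"] unfolding take_l t[symmetric]
          by (auto intro: cox_equiv.trans)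
        moreover have "set v \<subseteq> {1..m}"
          using v by force
        ultimately show ?thesis
          by (rule goalI[rotated])
      next
        case j: True
        \<comment> \<open>The appended top letter cancels, completes the zigzag, or moves left by
          commutation and a braid move and emerges in front as \<open>m\<close>.\<close>
        consider "l0 = 0" | "l0 = 2 * m - 1" | "1 \<le> l0" "l0 < 2 * m - 1"
          using 2 by linarith
        then show ?thesis
        proof cases
          case 1
          then show ?thesis
            using equiv_B_cancel[OF M(1)] j take_l by (intro goalI[of "[]" 0]) simp_all
        next
          case 2
          have "take l (zig ?M) @ [j] = [] @ take (length (zig ?M)) (zig ?M)"
            using take_l 2 len j by (simp add: zig_M del: zig.simps)
          then show ?thesis
            by (intro goalI[of "[]" "length (zig ?M)"]) (simp_all add: cox_equiv.refl del: zig.simps)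
        next
          case 3
          then obtain k where k: "m = Suc k" "1 \<le> k"
            using m by (cases m) auto
          have zig_m: "zig m = m # zig k @ [m]"
            using k by simp
          have len_k: "length (zig k) = 2 * k - 1"
            using length_zig k by simp
          define t where "t = take (l0 - 1) (zig k)"
          have take_l0: "take l0 (zig m) = m # t"
          proof (cases l0)
            case (Suc a)
            then have "a \<le> length (zig k)"
              using 3 len_k k by simp
            then show ?thesis
              unfolding zig_m t_def Suc by simp
          qed (use 3 in simp)
          have "set t \<subseteq> {1..k}"
            unfolding t_def by (rule subset_trans[OF set_take_subset set_zig])
          then have set_t: "set t \<subseteq> {1..n}" "set t \<subseteq> {1..?M - 2}"
            using m k by force+
          have "equiv_B n ([?M, m] @ (t @ [?M]) @ []) ([?M, m] @ (?M # t) @ [])"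
            by (rule cox_equiv_context[OF equiv_B_commute_word]) (use M m set_t in auto)
          moreover have "equiv_B n ([] @ [?M, m, ?M] @ t) ([] @ [m, ?M, m] @ t)"
            by (rule cox_equiv_context[OF cox_equiv.sym[OF equiv_B_braid]]) (use M k set_t in auto)
          ultimately have "equiv_B n (take l (zig ?M) @ [j]) ([m] @ take l (zig ?M))"
            unfolding take_l take_l0 j by (auto intro: cox_equiv.trans)
          then show ?thesis
            using m by (intro goalI[of "[m]" l]) simp_all
        qed
      qed
    next
      case 3
      then have full: "take l (zig ?M) = zig ?M"
        using len m by (simp add: zig_M del: zig.simps)
      show ?thesis
      proof (cases "j = ?M")
        case True
        have "equiv_B n ((?M # zig m) @ [?M, ?M] @ []) ((?M # zig m) @ [] @ [])"
          by (rule cox_equiv_context[OF equiv_B_cancel]) (use M set in auto)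
        moreover have "take (2 * m) (zig ?M) = ?M # zig m"
          using len m by (simp add: zig_M take_Cons' del: zig.simps)
        ultimately show ?thesis
          using full True unfolding zig_M
          by (intro goalI[of "[]" "2 * m", unfolded zig_M]) (simp_all del: zig.simps)
      next
        case False
        then have "equiv_B n (zig ?M @ [j]) (j # zig ?M)"
          using zig_commute[of ?M n j] Suc.prems by simp
        then show ?thesis
          using full Suc.prems False by (intro goalI[of "[j]" l]) (simp_all del: zig.simps)
      qed
    qed
  qed
qed simp

fun normal_words :: "nat \<Rightarrow> nat list set" where
  "normal_words 0 = {[]}"
| "normal_words (Suc m) = {v @ take l (zig (Suc m)) | v l. v \<in> normal_words m}"

fun longest_normal_word :: "nat \<Rightarrow> nat list" where
  "longest_normal_word 0 = []"
| "longest_normal_word (Suc m) = longest_normal_word m @ zig (Suc m)"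

lemma exists_normal_word:
  assumes "m \<le> n" "set u \<subseteq> {1..m}"
  shows "\<exists>v\<in>normal_words m. equiv_B n u v"
  using assms
proof (induction m arbitrary: u)
  case 0
  then show ?case
    by (auto simp: cox_equiv.refl)
next
  case (Suc m)
  let ?M = "Suc m"
  have "\<exists>w l. set w \<subseteq> {1..m} \<and> equiv_B n u (w @ take l (zig ?M))"
    using Suc.prems(2)
  proof (induction u rule: rev_induct)
    case Nil
    show ?case
      by (intro exI[of _ "[]"] exI[of _ 0]) (simp add: cox_equiv.refl)
  next
    case (snoc j u)
    then obtain w l where w: "set w \<subseteq> {1..m}" "equiv_B n u (w @ take l (zig ?M))"
      by auto
    obtain v l' where v: "set v \<subseteq> {1..m}" "equiv_B n (take l (zig ?M) @ [j]) (v @ take l' (zig ?M))"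
      using zig_prefix_snoc[of ?M n j l] snoc.prems Suc.prems(1) by auto
    have "equiv_B n ([] @ u @ [j]) ([] @ (w @ take l (zig ?M)) @ [j])"
      by (rule cox_equiv_context[OF w(2)]) (use snoc.prems Suc.prems(1) in auto)
    moreover have "equiv_B n (w @ (take l (zig ?M) @ [j]) @ []) (w @ (v @ take l' (zig ?M)) @ [])"
      by (rule cox_equiv_context[OF v(2)]) (use w(1) Suc.prems(1) in force)+
    ultimately have "equiv_B n (u @ [j]) ((w @ v) @ take l' (zig ?M))"
      by (simp del: zig.simps) (blast intro: cox_equiv.trans)
    then show ?case
      using w(1) v(1) by (intro exI[of _ "w @ v"] exI[of _ l']) (simp del: zig.simps)
  qed
  then obtain w l where w: "set w \<subseteq> {1..m}" "equiv_B n u (w @ take l (zig ?M))"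
    by blast
  then obtain v where v: "v \<in> normal_words m" "equiv_B n w v"
    using Suc.IH[of w] Suc.prems(1) by auto
  have "set (take l (zig ?M)) \<subseteq> {1..n}"
    using set_zig[of ?M] set_take_subset[of l "zig ?M"] Suc.prems(1) by force
  then have "equiv_B n ([] @ w @ take l (zig ?M)) ([] @ v @ take l (zig ?M))"
    by (intro cox_equiv_context[OF v(2)]) auto
  then have "equiv_B n u (v @ take l (zig ?M))"
    using w(2) by (auto intro: cox_equiv.trans simp del: zig.simps)
  with v(1) show ?case
    by (auto simp del: zig.simps)
qed

text \<open>Level \<open>i\<close> contributes at most \<open>2 * i - 1\<close> letters; these odd
  numbers add up to a square, and equality forces every segment to be complete.\<close>

lemma normal_words_props:
  assumes "v \<in> normal_words m"
  shows "set v \<subseteq> {1..m} \<and> length v \<le> m * m \<and> (length v = m * m \<longrightarrow> v = longest_normal_word m)"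
  using assms
proof (induction m arbitrary: v)
  case (Suc m)
  then obtain w l where v: "v = w @ take l (zig (Suc m))" and w: "w \<in> normal_words m"
    by auto
  have IH: "set w \<subseteq> {1..m}" "length w \<le> m * m" "length w = m * m \<Longrightarrow> w = longest_normal_word m"
    using Suc.IH[OF w] by auto
  have "set v \<subseteq> {1..Suc m}"
    using IH(1) set_zig[of "Suc m"] set_take_subset[of l "zig (Suc m)"] unfolding v set_append
    by force
  moreover have len: "length (take l (zig (Suc m))) \<le> 2 * m + 1" "length (zig (Suc m)) = 2 * m + 1"
    using length_zig[of "Suc m"] by simp_all
  moreover have "length v = length w + length (take l (zig (Suc m)))"
    by (simp only: v length_append)
  moreover have "take l (zig (Suc m)) = zig (Suc m)" if "length (take l (zig (Suc m))) = 2 * m + 1"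
    using that len by (metis length_take min.absorb_iff1 min_def take_all)
  ultimately show ?case
    using IH(2,3) by (auto simp: v simp del: zig.simps)
qed simp

section \<open>Folding type B into the symmetric group\<close>

text \<open>Type \<open>B\<close> acts on \<open>{1..2n}\<close> by permutations commuting with the reversal.\<close>

definition fold_letter :: "nat \<Rightarrow> nat \<Rightarrow> nat list" where
  "fold_letter n i = (if i = 1 then [n] else [n + i - 1, n + 1 - i])"

definition fold_word :: "nat \<Rightarrow> nat list \<Rightarrow> nat list" where
  "fold_word n u = concat (map (fold_letter n) u)"

lemma fold_word_simps [simp]:
  "fold_word n [] = []" "fold_word n (i # u) = fold_letter n i @ fold_word n u"
  "fold_word n (u @ v) = fold_word n u @ fold_word n v"
  by (simp_all add: fold_word_def)

lemma set_fold_letter: "set (fold_letter n i) = {n + i - 1, n + 1 - i}"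
  by (auto simp: fold_letter_def)

lemma set_fold_word:
  assumes "1 \<le> n" "set u \<subseteq> {1..n}"
  shows "set (fold_word n u) \<subseteq> {1..2 * n - 1}"
  using assms(2) by (induction u) (use assms(1) in \<open>auto simp: set_fold_letter\<close>)

section \<open>Coxeter relations among the folded generators\<close>

definition fold_perm :: "nat \<Rightarrow> nat \<Rightarrow> nat \<Rightarrow> nat" where
  "fold_perm n i = perm_of (fold_letter n i)"

lemma fold_perm_apply:
  assumes "1 \<le> i" "i \<le> n"
  shows "fold_perm n i x =
    (if x = n + i - 1 then n + i else if x = n + i then n + i - 1
     else if x = n + 1 - i then n + 2 - i else if x = n + 2 - i then n + 1 - i else x)"
proof (cases "i = 1")
  case True
  then show ?thesis
    using assms by (simp add: fold_perm_def fold_letter_def perm_of_Cons adj_transp_apply)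
next
  case False
  define d where "d = n - i"
  have d: "n = i + d"
    using assms by (simp add: d_def)
  then have "n + i - 1 = 2 * i + d - 1" "n + 1 - i = Suc d" "n + 2 - i = Suc (Suc d)"
    by auto
  moreover have "Suc (2 * i + d - 1) = n + i" "Suc (Suc d) < 2 * i + d - 1"
    using False assms d by auto
  ultimately show ?thesis
    using False by (auto simp: fold_perm_def fold_letter_def perm_of_Cons adj_transp_apply)
qed

text \<open>Writing \<open>i = Suc e\<close> and \<open>n = Suc e + d\<close> removes truncated
  subtraction from the case distinctions.\<close>

lemma fold_perm_shift:
  "fold_perm (Suc e + d) (Suc e) y =
    (if y = 2 * e + d + 1 then 2 * e + d + 2 else if y = 2 * e + d + 2 then 2 * e + d + 1
     else if y = d + 1 then d + 2 else if y = d + 2 then d + 1 else y)"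
  by (subst fold_perm_apply) auto

lemma shift_indices:
  assumes "1 \<le> i" "i \<le> n"
  obtains e d where "i = Suc e" "n = Suc e + d"
  using assms by (metis One_nat_def Suc_le_D le_Suc_ex)

lemma fold_perm_involutory:
  assumes "1 \<le> i" "i \<le> n"
  shows "fold_perm n i (fold_perm n i x) = x"
  using assms by (rule shift_indices) (auto simp: fold_perm_shift simp del: add_Suc)

text \<open>The two generators move disjoint sets of points, and the case split is on these
  sets.\<close>

lemma fold_perm_commute:
  assumes "1 \<le> i" "i + 1 < j" "j \<le> n"
  shows "fold_perm n i (fold_perm n j x) = fold_perm n j (fold_perm n i x)"
proof -
  obtain e where i: "i = Suc e"
    using assms(1) by (cases i) auto
  obtain g where j: "j = Suc (e + 2 + g)"
    using assms(2) by (auto simp: i dest!: less_imp_Suc_add)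
  obtain d where n: "n = Suc (e + 2 + g) + d"
    using assms(3) j le_Suc_ex by blast
  have n': "n = Suc e + (g + d + 2)"
    by (simp add: n)
  have f: "fold_perm n i y = (if y = 2 * e + g + d + 3 then 2 * e + g + d + 4
     else if y = 2 * e + g + d + 4 then 2 * e + g + d + 3
     else if y = g + d + 3 then g + d + 4 else if y = g + d + 4 then g + d + 3 else y)" for y
    unfolding i n' fold_perm_shift by simp
  have f': "fold_perm n j y = (if y = 2 * e + 2 * g + d + 5 then 2 * e + 2 * g + d + 6
     else if y = 2 * e + 2 * g + d + 6 then 2 * e + 2 * g + d + 5
     else if y = d + 1 then d + 2 else if y = d + 2 then d + 1 else y)" for y
    unfolding j n fold_perm_shift by simp
  consider "x \<in> {2 * e + g + d + 3, 2 * e + g + d + 4, g + d + 3, g + d + 4}"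
    | "x \<in> {2 * e + 2 * g + d + 5, 2 * e + 2 * g + d + 6, d + 1, d + 2}"
    | "x \<notin> {2 * e + g + d + 3, 2 * e + g + d + 4, g + d + 3, g + d + 4}"
      "x \<notin> {2 * e + 2 * g + d + 5, 2 * e + 2 * g + d + 6, d + 1, d + 2}"
    by blast
  then show ?thesis
  proof cases
    case 1
    then have "fold_perm n j x = x" "fold_perm n j (fold_perm n i x) = fold_perm n i x"
      unfolding f f' by auto
    then show ?thesis
      by simp
  next
    case 2
    then have "fold_perm n i x = x" "fold_perm n i (fold_perm n j x) = fold_perm n j x"
      unfolding f f' by auto
    then show ?thesis
      by simp
  next
    case 3
    then have "fold_perm n i x = x" "fold_perm n j x = x"
      unfolding f f' by simp_all
    then show ?thesis
      by simp
  qed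
qed

text \<open>For \<open>i\<close> at least \<open>2\<close> the moved points form two disjoint
  mirrored blocks of three, with an ordinary braid relation on each.\<close>

lemma fold_perm_braid:
  assumes "2 \<le> i" "Suc i \<le> n"
  shows "fold_perm n i (fold_perm n (Suc i) (fold_perm n i x))
    = fold_perm n (Suc i) (fold_perm n i (fold_perm n (Suc i) x))"
proof -
  obtain e where e: "i = Suc (Suc e)"
    using assms by (metis Suc_le_D numeral_2_eq_2 Suc_le_mono)
  obtain d where d: "n = Suc i + d"
    using assms le_Suc_ex by blast
  have f: "fold_perm n i y = (if y = 2 * e + d + 4 then 2 * e + d + 5 else if y = 2 * e + d + 5 then 2 * e + d + 4
     else if y = d + 2 then d + 3 else if y = d + 3 then d + 2 else y)" for y
    using assms by (subst fold_perm_apply) (auto simp: d e)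
  have g: "fold_perm n (Suc i) y = (if y = 2 * e + d + 5 then 2 * e + d + 6 else if y = 2 * e + d + 6 then 2 * e + d + 5
     else if y = d + 1 then d + 2 else if y = d + 2 then d + 1 else y)" for y
    using assms by (subst fold_perm_apply) (auto simp: d e)
  consider "x = 2 * e + d + 4" | "x = 2 * e + d + 5" | "x = 2 * e + d + 6" | "x = d + 1" | "x = d + 2" | "x = d + 3"
    | "x \<notin> {2 * e + d + 4, 2 * e + d + 5, 2 * e + d + 6, d + 1, d + 2, d + 3}"
    by blast
  then show ?thesis
    by cases (simp_all add: f g)
qed

lemma fold_perm_braid_4:
  assumes "2 \<le> n"
  shows "fold_perm n 1 (fold_perm n 2 (fold_perm n 1 (fold_perm n 2 x)))
    = fold_perm n 2 (fold_perm n 1 (fold_perm n 2 (fold_perm n 1 x)))"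
proof -
  obtain d where d: "n = d + 2"
    using assms by (metis add.commute le_Suc_ex)
  define f where "f = fold_perm n 1"
  define g where "g = fold_perm n 2"
  have f: "f y = (if y = d + 2 then d + 3 else if y = d + 3 then d + 2 else y)" for y
    unfolding f_def by (subst fold_perm_apply) (auto simp: d)
  have g: "g y = (if y = d + 3 then d + 4 else if y = d + 4 then d + 3
     else if y = d + 1 then d + 2 else if y = d + 2 then d + 1 else y)" for y
    unfolding g_def by (subst fold_perm_apply) (auto simp: d)
  have "f (d + 1) = d + 1" "f (d + 2) = d + 3" "f (d + 3) = d + 2" "f (d + 4) = d + 4"
    "g (d + 1) = d + 2" "g (d + 2) = d + 1" "g (d + 3) = d + 4" "g (d + 4) = d + 3"
    by (simp_all add: f g)
  moreover have "f x = x" "g x = x" if "x \<notin> {d + 1, d + 2, d + 3, d + 4}"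
    using that by (simp_all add: f g)
  moreover have "x = d + 1 \<or> x = d + 2 \<or> x = d + 3 \<or> x = d + 4 \<or> x \<notin> {d + 1, d + 2, d + 3, d + 4}"
    by blast
  ultimately have "f (g (f (g x))) = g (f (g (f x)))"
    by (elim disjE) (simp_all only: not_False_eq_True)
  then show ?thesis
    by (simp only: f_def g_def)
qed

lemma perm_of_fold_Cons: "perm_of (fold_word n (i # u)) x = fold_perm n i (perm_of (fold_word n u) x)"
  by (simp add: perm_of_append fold_perm_def)

lemma fold_relation:
  assumes i: "i \<in> {1..n}" and j: "j \<in> {1..n}"
  shows "perm_of (fold_word n (concat (replicate (cox_matrix_B i j) [i, j]))) = id"
proof
  fix x
  have ij: "1 \<le> i" "i \<le> n" "1 \<le> j" "j \<le> n"
    using assms by auto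
  have inv: "fold_perm n i (fold_perm n i y) = y" "fold_perm n j (fold_perm n j y) = y" for y
    using fold_perm_involutory ij by auto
  consider "i = j" | "{i, j} = {1, 2}" | "i \<noteq> j" "{i, j} \<noteq> {1, 2}" "i = j + 1 \<or> j = i + 1"
    | "i \<noteq> j" "i \<noteq> j + 1" "j \<noteq> i + 1"
    by blast
  then show "perm_of (fold_word n (concat (replicate (cox_matrix_B i j) [i, j]))) x = id x"
  proof cases
    case 1
    then show ?thesis
      using inv by (simp add: cox_matrix_B_diag perm_of_fold_Cons del: fold_word_simps(2))
  next
    case 2
    then have M: "cox_matrix_B i j = 4" and n: "2 \<le> n"
      using ij by (auto simp: cox_matrix_B_def doubleton_eq_iff)
    have "fold_perm n i (fold_perm n j (fold_perm n i (fold_perm n j y)))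
        = fold_perm n j (fold_perm n i (fold_perm n j (fold_perm n i y)))" for y
      using 2 fold_perm_braid_4[OF n] by (auto simp: doubleton_eq_iff)
    then show ?thesis
      using inv by (simp add: M numeral_eq_Suc perm_of_fold_Cons del: fold_word_simps(2))
  next
    case 3
    then have M: "cox_matrix_B i j = 3"
      by (auto simp: cox_matrix_B_def)
    have "fold_perm n i (fold_perm n j (fold_perm n i y))
        = fold_perm n j (fold_perm n i (fold_perm n j y))" for y
      using 3(3)
    proof
      assume "j = i + 1"
      moreover have "2 \<le> i"
        using 3 ij \<open>j = i + 1\<close> by (cases "i = 1") auto
      ultimately show ?thesis
        using fold_perm_braid[of i n] ij by simp
    next
      assume "i = j + 1"
      moreover have "2 \<le> j"
        using 3 ij \<open>i = j + 1\<close> by (cases "j = 1") auto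
      ultimately show ?thesis
        using fold_perm_braid[of j n] ij by simp
    qed
    then show ?thesis
      using inv by (simp add: M numeral_eq_Suc perm_of_fold_Cons del: fold_word_simps(2))
  next
    case 4
    then have M: "cox_matrix_B i j = 2"
      using ij by (auto simp: cox_matrix_B_def doubleton_eq_iff)
    have "fold_perm n i (fold_perm n j y) = fold_perm n j (fold_perm n i y)" for y
    proof (cases i j rule: linorder_cases)
      case less
      then show ?thesis
        using 4 ij fold_perm_commute[of i j n] by simp
    next
      case greater
      then show ?thesis
        using 4 ij fold_perm_commute[of j i n] by simp
    qed (use 4 in simp)
    then show ?thesis
      using inv by (simp add: M numeral_eq_Suc perm_of_fold_Cons del: fold_word_simps(2))
  qed
qed

lemma equiv_B_fold: "equiv_B n u v \<Longrightarrow> perm_of (fold_word n u) = perm_of (fold_word n v)"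
proof (induction rule: cox_equiv.induct)
  case (rel i j u v)
  then show ?case
    using fold_relation[of i n j] by (simp add: perm_of_append)
qed auto

section \<open>Letters and length of folded words\<close>

lemma distinct_fold_word:
  assumes "distinct u" "set u \<subseteq> {1..n}"
  shows "distinct (fold_word n u)"
  using assms
proof (induction u)
  case (Cons i u)
  have "set (fold_letter n i) \<inter> set (fold_letter n j) = {}" if "j \<in> set u" for j
  proof -
    have "1 \<le> i" "i \<le> n" "1 \<le> j" "j \<le> n" "i \<noteq> j"
      using that Cons.prems by auto
    then show ?thesis
      by (auto simp: set_fold_letter)
  qed
  then have "set (fold_letter n i) \<inter> set (fold_word n u) = {}"
    by (auto simp: fold_word_def)
  moreover have "distinct (fold_letter n i)"
    using Cons.prems by (auto simp: fold_letter_def)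
  ultimately show ?case
    using Cons by simp
qed simp

text \<open>The index \<open>n + i - 1\<close> occurs in the image of no letter other than
  \<open>i\<close>, so the support argument for permutations applies to the folded words.\<close>

lemma fold_word_equal_letters:
  assumes "perm_of (fold_word n u) = perm_of (fold_word n w)" "distinct w"
    "set u \<subseteq> {1..n}" "set w \<subseteq> {1..n}"
  shows "set w \<subseteq> set u"
proof
  fix i
  assume i: "i \<in> set w"
  then have "n + i - 1 \<in> set (fold_word n w)"
    by (force simp: fold_word_def set_fold_letter)
  then have "n + i - 1 \<in> set (fold_word n u)"
    using perm_of_single_letter_needed[OF assms(1)] distinct_fold_word[OF assms(2,4)] by blast
  then obtain j where j: "j \<in> set u" "n + i - 1 = n + j - 1 \<or> n + i - 1 = n + 1 - j"
    by (auto simp: fold_word_def set_fold_letter)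
  moreover have "1 \<le> i" "1 \<le> j" "j \<le> n"
    using i j assms(3,4) by auto
  ultimately have "i = j"
    by auto
  with j show "i \<in> set u"
    by simp
qed

lemma map_periodic_letter: "map (periodic_letter w) [0..<k * length w] = concat (replicate k w)"
proof (induction k)
  case (Suc k)
  have "map (periodic_letter w) [k * length w..<k * length w + length w] = w"
    by (rule nth_equalityI) (auto simp: periodic_letter_def)
  moreover have "[0..<Suc k * length w] = [0..<k * length w] @ [k * length w..<k * length w + length w]"
    using upt_add_eq_append[of 0 "k * length w" "length w"] by (simp add: add.commute)
  moreover have "concat (replicate (Suc k) w) = concat (replicate k w) @ w"
    unfolding replicate_append_same[symmetric] replicate_Suc by (simp add: replicate_append_same[symmetric])
  ultimately show ?case
    using Suc by simp
qed simp

lemma fold_word_concat_replicate: "fold_word n (concat (replicate k w)) = concat (replicate k (fold_word n w))"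
  by (induction k) simp_all

text \<open>Appending the letter \<open>n\<close> changes the entry at only one index up to
  \<open>n\<close>; any other letter merely permutes the indices counted.\<close>

lemma card_high_values:
  assumes "set w \<subseteq> {1..N}" "1 \<le> n"
  shows "card {a. 1 \<le> a \<and> a \<le> n \<and> n < perm_of w a} \<le> count_list w n"
  using assms(1)
proof (induction w rule: rev_induct)
  case (snoc j w)
  let ?S = "\<lambda>f. {a. 1 \<le> a \<and> a \<le> n \<and> n < (f a :: nat)}"
  have fin: "finite (?S f)" for f
    by (rule finite_subset[of _ "{..n}"]) auto
  show ?case
  proof (cases "j = n")
    case True
    have "?S (perm_of (w @ [j])) \<subseteq> insert n (?S (perm_of w))"
      using True by (auto simp: perm_of_snoc adj_transp_apply split: if_splits)
    then have "card (?S (perm_of (w @ [j]))) \<le> card (insert n (?S (perm_of w)))"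
      using fin by (intro card_mono) auto
    also have "\<dots> \<le> card (?S (perm_of w)) + 1"
      using fin by (simp add: card_insert_if)
    finally show ?thesis
      using snoc True by simp
  next
    case False
    have "?S (perm_of (w @ [j])) \<subseteq> adj_transp j ` ?S (perm_of w)"
    proof
      fix a
      assume a: "a \<in> ?S (perm_of (w @ [j]))"
      have "adj_transp j a \<in> ?S (perm_of w)"
        using a False snoc.prems by (auto simp: perm_of_snoc adj_transp_apply split: if_splits)
      then show "a \<in> adj_transp j ` ?S (perm_of w)"
        by (metis adj_transp_involutory image_eqI)
    qed
    then have "card (?S (perm_of (w @ [j]))) \<le> card (adj_transp j ` ?S (perm_of w))"
      using fin by (intro card_mono) auto
    also have "\<dots> \<le> card (?S (perm_of w))"
      using fin by (rule card_image_le)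
    finally show ?thesis
      using snoc False by simp
  qed
qed (simp add: assms)

text \<open>Folding doubles every letter except \<open>1\<close>. Inverting all pairs takes
  \<open>n * (2 * n - 1)\<close> folded letters, and moving the lower half up takes \<open>n\<close>
  letters \<open>n\<close>, which come from letters \<open>1\<close>; together they give the
  bound.\<close>

lemma length_ge_of_fold_reversal:
  assumes n: "1 \<le> n" and u: "set u \<subseteq> {1..n}" and rev: "perm_of (fold_word n u) = reversal (2 * n - 1)"
  shows "n * n \<le> length u"
proof -
  have length: "length (fold_word n u) + count_list u 1 = 2 * length u"
    by (induction u) (auto simp: fold_letter_def)
  have count: "count_list (fold_word n u) n = count_list u 1"
    using u by (induction u) (use n in \<open>auto simp: fold_letter_def\<close>)
  have set: "set (fold_word n u) \<subseteq> {1..2 * n - 1}"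
    using set_fold_word[OF n u] .
  have "{a. 1 \<le> a \<and> a \<le> n \<and> n < perm_of (fold_word n u) a} = {1..n}"
    unfolding rev by (auto simp: reversal_def)
  then have "n \<le> count_list u 1"
    using card_high_values[OF set n] count by simp
  moreover have "card (index_pairs (2 * n - 1)) \<le> length (fold_word n u)"
    using card_inversions_perm_of[OF set] by (simp add: rev inversions_reversal)
  moreover have "2 * card (index_pairs (2 * n - 1)) = 2 * ((2 * n - 1) * n)"
    using card_index_pairs[of "2 * n - 1"] n by (simp add: algebra_simps)
  ultimately have "(2 * n - 1) * n + n \<le> 2 * length u"
    using length by linarith
  moreover have "(2 * n - 1) * n + n = 2 * (n * n)"
    using n by (cases n) (simp_all add: algebra_simps)
  ultimately show ?thesis
    by linarith
qed

section \<open>Folded Coxeter words\<close>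

context coxeter_word
begin

lemma pos_in_less_append:
  assumes "cw = u @ v" "a \<in> set u" "b \<in> set v"
  shows "pos_in cw a < pos_in cw b"
proof -
  obtain p where p: "p < length u" "u ! p = a"
    using assms(2) by (auto simp: in_set_conv_nth)
  obtain q where q: "q < length v" "v ! q = b"
    using assms(3) by (auto simp: in_set_conv_nth)
  have len: "length u + length v = n"
    using length_cw assms(1) by simp
  have "pos_in cw a = p"
    using pos_in_nth[of p] p len by (simp add: assms(1) nth_append)
  moreover have "pos_in cw b = length u + q"
    using pos_in_nth[of "length u + q"] q len by (simp add: assms(1) nth_append)
  ultimately show ?thesis
    using p by simp
qed

lemma coxeter_word_fold: "coxeter_word (2 * n - 1) (fold_word n cw)"
proof
  show "1 \<le> 2 * n - 1"
    using n_pos by simp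
  show "distinct (fold_word n cw)"
    using distinct_fold_word[OF distinct_cw] set_cw by simp
  show "set (fold_word n cw) = {1..2 * n - 1}"
  proof
    show "{1..2 * n - 1} \<subseteq> set (fold_word n cw)"
    proof
      fix a
      assume a: "a \<in> {1..2 * n - 1}"
      define i where "i = (if a \<le> n then n + 1 - a else a + 1 - n)"
      have "i \<in> set cw" "a \<in> set (fold_letter n i)"
        using a by (auto simp: set_cw set_fold_letter i_def)
      then show "a \<in> set (fold_word n cw)"
        by (auto simp: fold_word_def)
    qed
  qed (use set_fold_word n_pos set_cw in auto)
qed

lemma pos_in_fold_less:
  assumes "1 \<le> i" "i \<le> n" "1 \<le> j" "j \<le> n" "pos_in cw i < pos_in cw j"
    and "a \<in> set (fold_letter n i)" "b \<in> set (fold_letter n j)"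
  shows "pos_in (fold_word n cw) a < pos_in (fold_word n cw) b"
proof -
  interpret folded: coxeter_word "2 * n - 1" "fold_word n cw"
    by (rule coxeter_word_fold)
  let ?p = "pos_in cw j"
  have "i \<in> set (take ?p cw)"
    using pos_in_props[OF assms(1,2)] assms(5) by (force simp: in_set_conv_nth length_cw)
  moreover have "cw ! ?p \<in> set (drop ?p cw)"
    using pos_in_props[OF assms(3,4)] by (force simp: in_set_conv_nth length_cw intro: exI[of _ 0])
  then have "j \<in> set (drop ?p cw)"
    using pos_in_props[OF assms(3,4)] by simp
  moreover have "fold_word n cw = fold_word n (take ?p cw) @ fold_word n (drop ?p cw)"
    by (simp flip: fold_word_simps(3))
  ultimately show ?thesis
    using assms(6,7)
    by (intro folded.pos_in_less_append[of "fold_word n (take ?p cw)" "fold_word n (drop ?p cw)"])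
      (auto simp: fold_word_def)
qed

text \<open>The edge at \<open>b\<close> is oriented opposite to its mirror edge at
  \<open>2 * n - 1 - b\<close>, so \<open>mult_Suc\<close> makes all multiplicities equal, and their
  known sum fixes the value.\<close>

lemma mult_fold:
  assumes "1 \<le> a" "a \<le> 2 * n - 1"
  shows "orientation.mult (2 * n - 1)
    (\<lambda>j. pos_in (fold_word n cw) j < pos_in (fold_word n cw) (Suc j)) a = n"
proof -
  interpret folded: coxeter_word "2 * n - 1" "fold_word n cw"
    by (rule coxeter_word_fold)
  let ?pos = "pos_in (fold_word n cw)"
  have asc: "?pos a < ?pos b \<longleftrightarrow> pos_in cw i < pos_in cw j"
    if "1 \<le> i" "i \<le> n" "1 \<le> j" "j \<le> n" "i \<noteq> j"
      "a \<in> set (fold_letter n i)" "b \<in> set (fold_letter n j)" for i j a b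
    using pos_in_fold_less[of i j a b] pos_in_fold_less[of j i b a] pos_in_inj[of i j] that
    by (metis linorder_neqE_nat not_less_iff_gr_or_eq)
  \<comment> \<open>Both edges come from the letters \<open>i\<close> and \<open>i + 1\<close>, met
    in opposite orders on the two sides of \<open>n\<close>.\<close>
  have mirror: "?pos (n - i) < ?pos (Suc (n - i)) \<longleftrightarrow> \<not> ?pos (n + i - 1) < ?pos (Suc (n + i - 1))"
    if "1 \<le> i" "i < n" for i
  proof -
    have "?pos (n - i) < ?pos (Suc (n - i)) \<longleftrightarrow> pos_in cw (Suc i) < pos_in cw i"
      by (rule asc) (use that in \<open>auto simp: set_fold_letter\<close>)
    moreover have "?pos (n + i - 1) < ?pos (Suc (n + i - 1)) \<longleftrightarrow> pos_in cw i < pos_in cw (Suc i)"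
      by (rule asc) (use that in \<open>auto simp: set_fold_letter\<close>)
    moreover have "pos_in cw i \<noteq> pos_in cw (Suc i)"
      using pos_in_inj[of i "Suc i"] that by auto
    ultimately show ?thesis
      by auto
  qed
  have sym: "?pos (2 * n - 1 - b) < ?pos (Suc (2 * n - 1 - b)) \<longleftrightarrow> \<not> ?pos b < ?pos (Suc b)"
    if "1 \<le> b" "b < 2 * n - 1" for b
  proof (cases "b < n")
    case True
    then have "n - (n - b) = b" "n + (n - b) - 1 = 2 * n - 1 - b"
      using that by auto
    then show ?thesis
      using mirror[of "n - b"] that True by auto
  next
    case False
    then have "n - (b + 1 - n) = 2 * n - 1 - b" "n + (b + 1 - n) - 1 = b"
      using that by auto
    then show ?thesis
      using mirror[of "b + 1 - n"] that False by auto
  qed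
  have const: "folded.mult b = folded.mult 1" if "1 \<le> b" "b \<le> 2 * n - 1" for b
    using that
  proof (induction b rule: dec_induct)
    case (step b)
    then show ?case
      using folded.mult_Suc[of b] sym[of b] by simp
  qed simp
  have "2 * (\<Sum>b = 1..2 * n - 1. folded.mult b) = (2 * n - 1) * (2 * n - 1 + 1)"
    by (rule folded.sum_mult)
  moreover have "(\<Sum>b = 1..2 * n - 1. folded.mult b) = (\<Sum>b = 1..2 * n - 1. folded.mult 1)"
    by (rule sum.cong[OF HOL.refl], rule const) simp_all
  ultimately have "(2 * n - 1) * (2 * folded.mult 1) = (2 * n - 1) * (2 * n)"
    using n_pos by simp
  then have "folded.mult 1 = n"
    using n_pos by simp
  with const[OF assms] show ?thesis
    by simp
qed

text \<open>All multiplicities equal \<open>n\<close>, so nothing is skipped in the first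
  \<open>n\<close> rounds of the folded word, and the symmetric group computation applies.\<close>

lemma perm_of_fold_power: "perm_of (fold_word n (concat (replicate n cw))) = reversal (2 * n - 1)"
proof -
  interpret folded: coxeter_word "2 * n - 1" "fold_word n cw"
    by (rule coxeter_word_fold)
  let ?N = "2 * n - 1"
  have "folded.kept p" if "p < n * ?N" for p
    unfolding folded.kept_def mult_fold[OF folded.periodic_letter_range]
    using that by (rule less_mult_imp_div_less)
  then have "folded.kept_word (n * ?N) = map (periodic_letter (fold_word n cw)) [0..<n * ?N]"
    unfolding folded.kept_word_def by (simp add: filter_id_conv)
  also have "\<dots> = fold_word n (concat (replicate n cw))"
    using map_periodic_letter[of "fold_word n cw" n]
    by (simp add: folded.length_cw fold_word_concat_replicate)
  finally have word: "folded.kept_word (n * ?N) = fold_word n (concat (replicate n cw))" .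
  have "count_list (folded.kept_word (n * ?N)) i = folded.mult i" if "1 \<le> i" "i \<le> ?N" for i
    using folded.count_kept_word[OF that, of "n * ?N"] n_pos mult_fold[OF that] by simp
  then show ?thesis
    using folded.perm_of_complete[OF folded.admissible_kept_word] unfolding word[symmetric] by blast
qed

end

text \<open>A folded generator acts on mirror pairs of points and so commutes with the reversal;
  this becomes centrality of the longest element.\<close>

lemma fold_perm_reversal:
  assumes "1 \<le> i" "i \<le> n"
  shows "fold_perm n i (reversal (2 * n - 1) (fold_perm n i x)) = reversal (2 * n - 1) x"
proof -
  obtain e d where i: "i = Suc e" and n: "n = Suc e + d"
    using assms by (rule shift_indices)
  have f: "fold_perm n i y = (if y = 2 * e + d + 1 then 2 * e + d + 2 else if y = 2 * e + d + 2 then 2 * e + d + 1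
     else if y = d + 1 then d + 2 else if y = d + 2 then d + 1 else y)" for y
    unfolding i n by (rule fold_perm_shift)
  have r: "reversal (2 * n - 1) y = (if 1 \<le> y \<and> y \<le> 2 * e + 2 * d + 2 then 2 * e + 2 * d + 3 - y else y)" for y
    unfolding reversal_def n by auto
  have f_values: "fold_perm n i (2 * e + d + 1) = 2 * e + d + 2" "fold_perm n i (2 * e + d + 2) = 2 * e + d + 1"
    "fold_perm n i (d + 1) = d + 2" "fold_perm n i (d + 2) = d + 1"
    by (simp_all add: f)
  have r_values: "reversal (2 * n - 1) (2 * e + d + 1) = d + 2" "reversal (2 * n - 1) (2 * e + d + 2) = d + 1"
    "reversal (2 * n - 1) (d + 1) = 2 * e + d + 2" "reversal (2 * n - 1) (d + 2) = 2 * e + d + 1"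
    unfolding r by simp_all
  consider "x = 2 * e + d + 1" | "x = 2 * e + d + 2" | "x = d + 1" | "x = d + 2"
    | "x \<notin> {2 * e + d + 1, 2 * e + d + 2, d + 1, d + 2}"
    by blast
  then show ?thesis
  proof cases
    case 5
    then have "fold_perm n i x = x"
      by (simp add: f)
    moreover have "reversal (2 * n - 1) x \<notin> {2 * e + d + 1, 2 * e + d + 2, d + 1, d + 2}"
      using 5 assms unfolding r by (auto split: if_splits)
    then have "fold_perm n i (reversal (2 * n - 1) x) = reversal (2 * n - 1) x"
      by (simp add: f)
    ultimately show ?thesis
      by simp
  qed (simp_all only: f_values r_values)
qed

section \<open>Type B\<close>

locale type_B =
  fixes G :: "('a, 'b) monoid_scheme" (structure) and s :: "nat \<Rightarrow> 'a" and n :: nat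
  assumes system: "coxeter_system G s n cox_matrix_B" and n_pos: "1 \<le> n"
begin

sublocale group G
  using system by (simp add: coxeter_system_def)

abbreviation wp :: "nat list \<Rightarrow> 'a" where
  "wp \<equiv> word_prod G s"

lemma s_closed: "i \<in> {1..n} \<Longrightarrow> s i \<in> carrier G"
  using system by (auto simp: coxeter_system_def)

lemma wp_eq_iff:
  "set u \<subseteq> {1..n} \<Longrightarrow> set v \<subseteq> {1..n} \<Longrightarrow> wp u = wp v \<longleftrightarrow> equiv_B n u v"
  using system unfolding coxeter_system_def by blast

lemma wp_Nil: "wp [] = \<one>" and wp_Cons: "wp (i # u) = s i \<otimes> wp u"
  by (simp_all add: word_prod_def)

lemma wp_closed: "set u \<subseteq> {1..n} \<Longrightarrow> wp u \<in> carrier G"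
  by (induction u) (auto simp: wp_Nil wp_Cons s_closed)

lemma wp_append:
  "set u \<subseteq> {1..n} \<Longrightarrow> set v \<subseteq> {1..n} \<Longrightarrow> wp (u @ v) = wp u \<otimes> wp v"
  by (induction u) (auto simp: wp_Nil wp_Cons s_closed wp_closed m_assoc)

lemma wp_single: "i \<in> {1..n} \<Longrightarrow> wp [i] = s i"
  by (simp add: wp_Nil wp_Cons s_closed)

lemma s_square: "i \<in> {1..n} \<Longrightarrow> s i \<otimes> s i = \<one>"
  using wp_eq_iff[of "[i, i]" "[]"] equiv_B_cancel[of i n] by (simp add: wp_Nil wp_Cons s_closed)

lemma exists_word:
  assumes "x \<in> carrier G"
  shows "\<exists>u. set u \<subseteq> {1..n} \<and> wp u = x"
proof -
  have "x \<in> generate G (s ` {1..n})"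
    using assms system by (simp add: coxeter_system_def)
  then show ?thesis
  proof induction
    case one
    show ?case
      by (intro exI[of _ "[]"]) (simp add: wp_Nil)
  next
    case (incl h)
    then show ?case
      using wp_single by (metis imageE empty_subsetI insert_subset list.simps(15) set_empty)
  next
    case (inv h)
    then obtain i where i: "i \<in> {1..n}" "h = s i"
      by blast
    then have "inv h = s i"
      using s_square s_closed by (intro inv_equality) auto
    then show ?case
      using i wp_single[of i] by (intro exI[of _ "[i]"]) auto
  next
    case (eng h1 h2)
    then obtain u v where "set u \<subseteq> {1..n}" "wp u = h1" "set v \<subseteq> {1..n}" "wp v = h2"
      by blast
    then show ?case
      using wp_append by (intro exI[of _ "u @ v"]) auto
  qed
qed

lemma cox_length_bound:
  assumes "x \<in> carrier G"
  shows "cox_length G s n x \<le> n * n"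
    and "cox_length G s n x = n * n \<Longrightarrow> x = wp (longest_normal_word n)"
proof -
  obtain u where u: "set u \<subseteq> {1..n}" "wp u = x"
    using exists_word[OF assms] by blast
  then obtain v where v: "v \<in> normal_words n" "equiv_B n u v"
    using exists_normal_word[of n n u] by blast
  then have v_props: "set v \<subseteq> {1..n}" "length v \<le> n * n" "length v = n * n \<Longrightarrow> v = longest_normal_word n"
    using normal_words_props by auto
  have x: "wp v = x"
    using u(2) wp_eq_iff[OF u(1) v_props(1)] v(2) by simp
  have "cox_length G s n x \<le> length v"
    by (rule cox_length_le[OF v_props(1) x])
  then show "cox_length G s n x \<le> n * n"
    and "cox_length G s n x = n * n \<Longrightarrow> x = wp (longest_normal_word n)"
    using v_props x by auto
qed

text \<open>Normal words give the upper bound; the lower bound holds for every word of this element,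
  since all of them fold to the reversal.\<close>

lemma cox_length_fold_reversal:
  assumes u: "set u \<subseteq> {1..n}" "perm_of (fold_word n u) = reversal (2 * n - 1)"
  shows "cox_length G s n (wp u) = n * n"
proof (rule antisym)
  show "cox_length G s n (wp u) \<le> n * n"
    by (rule cox_length_bound(1)[OF wp_closed[OF u(1)]])
  obtain v where v: "set v \<subseteq> {1..n}" "length v = cox_length G s n (wp u)" "wp v = wp u"
    using exists_shortest_word[OF u(1), of G s "wp u"] by blast
  then have "perm_of (fold_word n v) = reversal (2 * n - 1)"
    using u(2) wp_eq_iff[OF v(1) u(1)] equiv_B_fold[of n v u] by simp
  then show "n * n \<le> cox_length G s n (wp u)"
    using length_ge_of_fold_reversal[OF n_pos v(1)] v(2) by simp
qed

text \<open>Maximal length leaves one candidate. This takes the place of injectivity of the folding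
  map.\<close>

lemma fold_reversal_unique:
  assumes "set u \<subseteq> {1..n}" "perm_of (fold_word n u) = reversal (2 * n - 1)"
  shows "wp u = wp (longest_normal_word n)"
  by (rule cox_length_bound(2)[OF wp_closed[OF assms(1)] cox_length_fold_reversal[OF assms]])

lemma longest_element_eq:
  assumes "set u \<subseteq> {1..n}" "perm_of (fold_word n u) = reversal (2 * n - 1)"
  shows "longest_element G s n = wp u"
  unfolding longest_element_def
proof (rule the_equality)
  show "wp u \<in> carrier G \<and> (\<forall>x\<in>carrier G. cox_length G s n x \<le> cox_length G s n (wp u))"
    using cox_length_bound(1) cox_length_fold_reversal[OF assms] wp_closed[OF assms(1)] by simp
  fix w
  assume w: "w \<in> carrier G \<and> (\<forall>x\<in>carrier G. cox_length G s n x \<le> cox_length G s n w)"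
  then have "n * n \<le> cox_length G s n w"
    using cox_length_fold_reversal[OF assms] wp_closed[OF assms(1)] by metis
  then show "w = wp u"
    using w cox_length_bound[of w] fold_reversal_unique[OF assms] by (simp add: le_antisym)
qed

lemma s_inj: "inj_on s {1..n}"
proof (rule inj_onI)
  fix i j
  assume ij: "i \<in> {1..n}" "j \<in> {1..n}" "s i = s j"
  then have "equiv_B n [i] [j]"
    using wp_eq_iff[of "[i]" "[j]"] by (simp add: wp_single)
  then show "i = j"
    using fold_word_equal_letters[OF equiv_B_fold, of n "[i]" "[j]"] ij by simp
qed

lemma coxeter_word_of_reduced:
  assumes "coxeter_element G s n c" "reduced_word G s n cw c"
  shows "coxeter_word n cw"
proof -
  obtain ws where ws: "distinct ws" "set ws = {1..n}" "wp ws = c"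
    using assms(1) by (auto simp: coxeter_element_def)
  have cw: "set cw \<subseteq> {1..n}" "wp cw = c" "length cw = cox_length G s n c"
    using assms(2) by (auto simp: reduced_word_def)
  then have "equiv_B n cw ws"
    using ws wp_eq_iff[of cw ws] by simp
  then have "set ws \<subseteq> set cw"
    using fold_word_equal_letters[OF equiv_B_fold] ws cw by blast
  with cw ws have set_cw: "set cw = {1..n}"
    by blast
  have "length cw \<le> length ws"
    unfolding cw by (rule cox_length_le) (use ws in auto)
  also have "\<dots> = n"
    using distinct_card[OF ws(1)] ws(2) by simp
  finally have "distinct cw"
    using set_cw by (intro card_distinct) (metis card_atLeastAtMost card_length diff_Suc_1 le_antisym)
  with n_pos set_cw show ?thesis
    by unfold_locales auto
qed

text \<open>
  Conjugating the longest element by a generator gives an element with the same image in the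
  symmetric group, which is again longest: so the longest element is central.
\<close>

lemma psi_eq:
  assumes u: "set u \<subseteq> {1..n}" "perm_of (fold_word n u) = reversal (2 * n - 1)" and i: "i \<in> {1..n}"
  shows "psi G s n (s i) = s i"
proof -
  have "perm_of (fold_word n ([i] @ u @ [i])) = reversal (2 * n - 1)"
    using fold_perm_reversal[of i n] i
    by (intro ext) (simp add: perm_of_append u(2) flip: fold_perm_def)
  then have "wp ([i] @ u @ [i]) = wp u"
    using fold_reversal_unique[of "[i] @ u @ [i]"] fold_reversal_unique[OF u] i u by simp
  then have conj: "s i \<otimes> wp u \<otimes> s i = wp u"
    using i u by (simp add: wp_append wp_single wp_Cons wp_closed s_closed m_assoc wp_Nil)
  have "s i \<otimes> wp u = s i \<otimes> wp u \<otimes> s i \<otimes> s i"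
    using i u by (simp add: s_square s_closed wp_closed m_assoc)
  also have "\<dots> = wp u \<otimes> s i"
    unfolding conj ..
  finally have commute: "s i \<otimes> wp u = wp u \<otimes> s i" .
  have "psi G s n (s i) = inv (wp u) \<otimes> (s i \<otimes> wp u)"
    using i u by (simp add: psi_def longest_element_eq[OF u] s_closed wp_closed m_assoc)
  also have "\<dots> = s i"
    unfolding commute using i u by (simp add: s_closed wp_closed flip: m_assoc)
  finally show ?thesis .
qed

text \<open>The \<open>n\<close> copies of \<open>cw\<close> form a reduced word on the first
  \<open>n * n\<close> positions without a gap, so no sequence of that length comes earlier.\<close>

lemma sorting_word_eq:
  assumes "coxeter_word n cw"
  shows "sorting_word G s n cw = concat (replicate n cw)"
proof -
  interpret coxeter_word n cw
    by (rule assms)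
  let ?u = "concat (replicate n cw)"
  have set_u: "set ?u \<subseteq> {1..n}"
    using set_cw by auto
  note longest = longest_element_eq[OF set_u perm_of_fold_power]
  note len = cox_length_fold_reversal[OF set_u perm_of_fold_power]
  have word: "map (periodic_letter cw) [0..<n * n] = ?u"
    using map_periodic_letter[of cw n] by (simp add: length_cw)
  have length_u: "length ?u = n * n"
    unfolding word[symmetric] by simp
  have ps: "longest_subword G s n cw [0..<n * n]"
    unfolding longest_subword_def reduced_word_def longest len word
    using set_u length_u by simp
  have "sorting_word G s n cw = map (periodic_letter cw) [0..<n * n]"
  proof (rule sorting_word_eqI[OF ps], rule ccontr)
    fix qs
    assume qs: "longest_subword G s n cw qs" and ne: "[0..<n * n] \<noteq> qs" "([0..<n * n], qs) \<notin> lexord less_than"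
    have "sorted_wrt (<) qs" "length qs = n * n"
      using qs by (auto simp: longest_subword_def reduced_word_def longest len)
    then obtain b a where "b \<notin> set [0..<n * n]" "a \<in> set [0..<n * n]" "b < a"
      using sorted_lists_first_difference[of "[0..<n * n]" qs] ne by auto
    then show False
      by simp
  qed
  then show ?thesis
    by (simp add: word)
qed

end

lemma rotate_pair_cw_sym_pair:
  "(rotate_pair_cw m ^^ l) (sym_pair m a b) = sym_pair m (a + int l) (b + int l)"
proof (induction l)
  case (Suc l)
  have "rotate_cw (2 * m) (diagonal (2 * m) x y) = diagonal (2 * m) (x + 1) (y + 1)" for x y
    using rotate_cw_diagonal[of 1 "2 * m" x y] by simp
  then show ?case
    using Suc by (simp add: rotate_pair_cw_def sym_pair_def ac_simps)
qed simp

text \<open>A half turn exchanges the two diagonals of a pair.\<close>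

lemma sym_pair_half_turn: "sym_pair m (a + int m) (b + int m) = sym_pair m a b"
proof -
  have "diagonal (2 * m) (a + int m + int m) (b + int m + int m) = diagonal (2 * m) a b"
    by (simp add: diagonal_def add.assoc flip: mult_2)
  then show ?thesis
    by (auto simp: sym_pair_def)
qed

text \<open>Every letter is its own dual and occurs \<open>k + n = m\<close> times, so the required
  identity says that \<open>m\<close> rotations, a half turn, fix its first pair.\<close>

lemma Theta_rotates_B:
  assumes m: "k < m" "n = m - k"
    and system: "coxeter_system W s n cox_matrix_B"
    and c: "coxeter_element W s n c" "reduced_word W s n cw c"
    and Q: "Q = Q_word W s n k cw"
    and q: "q < length Q"
  shows "phi_B m cw Q (Theta W s n Q q) = rotate_pair_cw m (phi_B m cw Q q)"
proof -
  interpret type_B W s n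
    using system m by unfold_locales auto
  interpret coxeter_word n cw
    by (rule coxeter_word_of_reduced[OF c])
  have Q: "Q = concat (replicate k cw) @ concat (replicate n cw)"
    unfolding Q Q_word_def sorting_word_eq[OF coxeter_word_axioms] ..
  have set_Q: "set Q = {1..n}"
    using set_cw n_pos by (auto simp: Q)
  have set_u: "set (concat (replicate n cw)) \<subseteq> {1..n}"
    using set_cw by auto
  define base where
    "base i = sym_pair m (int (ascents_below cw i)) (int m - int (descents_below cw i))" for i
  show ?thesis
  proof (rule Theta_rotates[OF q, where dual = "\<lambda>i. i" and base = base])
    show "inj_on s (set Q)"
      unfolding set_Q by (rule s_inj)
    show "i \<in> set Q \<and> psi W s n (s i) = s i" if "i \<in> set Q" for i
      using that psi_eq[OF set_u perm_of_fold_power] by (simp add: set_Q)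
    show "phi_B m cw Q q = (rotate_pair_cw m ^^ (occurrence Q q - 1)) (base (Q ! q))" for q
      by (simp add: phi_B_def base_def Let_def)
    fix i
    assume "i \<in> set Q"
    then have "count_list cw i = 1"
      using count_cw by (simp add: set_Q)
    then have "count_list Q i = m"
      using m by (simp add: Q count_list_concat_replicate)
    then show "base i = (rotate_pair_cw m ^^ count_list Q i) (base i)"
      unfolding base_def rotate_pair_cw_sym_pair by (simp only: sym_pair_half_turn)
  qed
qed

theorem theorem8p10:
  shows
   "(\<forall>k m n c cw Q.
       1 \<le> k \<longrightarrow> 2 * k + 2 \<le> m \<longrightarrow> n = m - 2 * k - 1 \<longrightarrow>
       coxeter_element (sym_group (n + 1)) adj_transp n c \<longrightarrow>
       reduced_word (sym_group (n + 1)) adj_transp n cw c \<longrightarrow>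
       Q = Q_word (sym_group (n + 1)) adj_transp n k cw \<longrightarrow>
       (\<forall>q < length Q.
          phi_A k m cw Q (Theta (sym_group (n + 1)) adj_transp n Q q) =
            rotate_cw m (phi_A k m cw Q q)))
    \<and>
    (\<forall>k m n (W :: ('a, 'b) monoid_scheme) s c cw Q.
       1 \<le> k \<longrightarrow> k < m \<longrightarrow> n = m - k \<longrightarrow>
       coxeter_system W s n cox_matrix_B \<longrightarrow>
       coxeter_element W s n c \<longrightarrow>
       reduced_word W s n cw c \<longrightarrow>
       Q = Q_word W s n k cw \<longrightarrow>
       (\<forall>q < length Q.
          phi_B m cw Q (Theta W s n Q q) = rotate_pair_cw m (phi_B m cw Q q)))"
  by (intro conjI allI impI) (rule Theta_rotates_A Theta_rotates_B; assumption)+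

end
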